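(* Let $Z$ be a random variable taking nonnegative integer values such that $\mathbb{E}Z<\infty$ and $Z\ge2$ almost surely. Let $\mathbf{h}_X$ and $\mathbf{h}_Y$ be the asymptotic entropies of simple random walk and of nonbacktracking random walk, respectively, on a Galton--Watson tree with offspring variable $Z$. Then $\mathbf{h}_X<\mathbf{h}_Y$.
   Context: Let $(T,\rho)$ be a rooted Galton--Watson tree with offspring variable $Z$. Let $(X_t)_{t\ge0}$ be simple random walk (SRW) on $T$ started at $\rho$, and let $(Y_t)_{t\ge0}$ be the nonbacktracking random walk (NBRW) on $T$ started at $Y_0=\rho$: $Y_1$ is a uniform neighbor of $\rho$, and for $t\ge1$, $Y_{t+1}$ is uniform among the neighbors of $Y_t$ other than $Y_{t-1}$. For a probability measure $\mu$ on the vertices of $T$, its entropy is $H(\mu)=-\sum_{x\in T}\mu(x)\log\mu(x)$. The asymptotic entropies are the almost sure constant limits $$\mathbf{h}_X=\lim_{t\to\infty}\tfrac1t H\big(\mathbb{P}_\rho(X_t\in\cdot\mid T)\big),\qquad \mathbf{h}_Y=\lim_{t\to\infty}\tfrac1t H\big(\mathbb{P}_\rho(Y_t\in\cdot\mid T)\big).$$ *)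

theory Defs
  imports "HOL-Probability.Probability"
begin

section \<open>Random walks on a graph given by its neighbour sets\<close>

primrec srw :: "('v \<Rightarrow> 'v set) \<Rightarrow> 'v \<Rightarrow> nat \<Rightarrow> 'v pmf" where
  "srw nb r 0 = return_pmf r"
| "srw nb r (Suc t) = bind_pmf (srw nb r t) (\<lambda>x. pmf_of_set (nb x))"

text \<open>Law of the pair formed by the positions of the nonbacktracking walk at times
  \<open>t\<close> and \<open>t + 1\<close>.\<close>

primrec nbrw_step :: "('v \<Rightarrow> 'v set) \<Rightarrow> 'v \<Rightarrow> nat \<Rightarrow> ('v \<times> 'v) pmf" where
  "nbrw_step nb r 0 = map_pmf (Pair r) (pmf_of_set (nb r))"
| "nbrw_step nb r (Suc t) =
     bind_pmf (nbrw_step nb r t) (\<lambda>(x, y). map_pmf (Pair y) (pmf_of_set (nb y - {x})))"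

primrec nbrw :: "('v \<Rightarrow> 'v set) \<Rightarrow> 'v \<Rightarrow> nat \<Rightarrow> 'v pmf" where
  "nbrw nb r 0 = return_pmf r"
| "nbrw nb r (Suc t) = map_pmf snd (nbrw_step nb r t)"

text \<open>Terms with \<open>pmf p x = 0\<close> vanish because \<open>0 * ln 0 = 0\<close>. For the walks on a
  locally finite graph the sum has finitely many nonzero terms.\<close>

definition pmf_entropy :: "'v pmf \<Rightarrow> real" where
  "pmf_entropy p = - (\<Sum>\<^sub>\<infinity>x. pmf p x * ln (pmf p x))"

section \<open>Galton--Watson trees\<close>

text \<open>Ulam--Harris encoding: vertices are words over the natural numbers, the root is the
  empty word, and the children of a vertex \<open>u\<close> are the words \<open>u @ [k]\<close> with \<open>k < c u\<close>. The
  values of \<open>c\<close> outside the tree play no role.\<close>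

definition tree_of :: "(nat list \<Rightarrow> nat) \<Rightarrow> nat list set" where
  "tree_of c = {u. \<forall>i<length u. u ! i < c (take i u)}"

definition tree_nb :: "nat list set \<Rightarrow> nat list \<Rightarrow> nat list set" where
  "tree_nb T x = {y \<in> T. (\<exists>k. y = x @ [k]) \<or> (\<exists>k. x = y @ [k])}"

text \<open>\<open>N u\<close> is the number of children of \<open>u\<close>; the tree at the sample point \<open>\<omega>\<close> is
  \<open>tree_of (\<lambda>u. N u \<omega>)\<close>.\<close>

definition galton_watson ::
  "'a measure \<Rightarrow> (nat list \<Rightarrow> 'a \<Rightarrow> nat) \<Rightarrow> 'b measure \<Rightarrow> ('b \<Rightarrow> nat) \<Rightarrow> bool" where
  "galton_watson P N M Z \<longleftrightarrow>
     prob_space P \<and>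
     prob_space.indep_vars P (\<lambda>_. count_space UNIV) N UNIV \<and>
     (\<forall>u. distr P (count_space UNIV) (N u) = distr M (count_space UNIV) Z)"

text \<open>\<open>law \<omega> t\<close> is the quenched law at time \<open>t\<close> of a walk on the tree at \<open>\<omega>\<close>.\<close>

definition asymptotic_entropy :: "'a measure \<Rightarrow> ('a \<Rightarrow> nat \<Rightarrow> 'v pmf) \<Rightarrow> real \<Rightarrow> bool" where
  "asymptotic_entropy P law h \<longleftrightarrow>
     (AE \<omega> in P. (\<lambda>t. pmf_entropy (law \<omega> t) / real t) \<longlonglongrightarrow> h)"

end

theory Submission
  imports Defs "HOL-Real_Asymp.Real_Asymp"
begin

text \<open>
Write \<open>Z\<close> for the offspring variable and \<open>drift z = z / (z + 1) * ln z\<close>. The two entropies are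
separated by
  \<open>h_X \<le> E (drift Z) < E (ln Z) \<le> h_Y\<close>,
where the strict inequality is clear because \<open>Z \<ge> 2\<close>.

The nonbacktracking walk started at the root never turns back, so its law at time \<open>t\<close> is the
visibility measure on level \<open>t\<close>: each vertex splits its mass equally among its children. The
entropy of that law is a sum, over the levels below \<open>t\<close>, of averages of logarithms of offspring
numbers, and its mean over the tree is \<open>t * E (ln Z)\<close> (\<open>nbrw_eq_vis\<close>, \<open>entropy_vis\<close>, \<open>vsum_mean\<close>).

For simple random walk, Gibbs' inequality compares the law of \<open>X t\<close> with the sum of the visibility
measures of levels \<open>0, ..., t\<close>. The logarithmic cost of a vertex \<open>x\<close> increases by \<open>ln (c x)\<close>, with
\<open>c x\<close> the number of children, when the walk steps from \<open>x\<close> to a child, and does not increase when it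
steps to the parent. A vertex other than the root has \<open>c x + 1\<close> neighbours, and the contribution of the
root can be discarded. Hence the entropy at time \<open>t\<close> is at most
  \<open>(\<Sum>s<t. E (drift (c (X s)))) + O(ln t)\<close> (\<open>srw_entropy_le\<close>),
and everything comes down to the average of \<open>drift\<close> along the walk. On the Galton--Watson tree this
average is awkward, because the environment seen from the walker is not stationary. It is
stationary on the augmented tree, where the root has \<open>Z + 1\<close> children instead of \<open>Z\<close>; there every
vertex has one more neighbour than its offspring variable, and the average of \<open>drift\<close> is exactly
\<open>E (drift Z)\<close>.

The passage between the two trees uses discounted sums \<open>\<Sum>s. l ^ s * E (f (c (X s)))\<close> for \<open>l < 1\<close>.
They are rational expressions in two functionals of the branches at the root: \<open>hit\<close>, the generating
function of the time of the first step from the branch to its parent, and \<open>occ\<close>, the discounted sum up to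
that time. Deleting one of the \<open>Z + 1\<close> branches of the augmented tree leaves a Galton--Watson tree,
and the discounted sum of the augmented tree is a convex combination of those of the pruned trees
(\<open>agw_value_ge_min\<close>). The entropy rate \<open>h_X\<close> is the same constant for all pruned trees, so it
bounds the augmented discounted rate from below, and Fatou's lemma gives \<open>h_X \<le> E (drift Z)\<close>
(\<open>discounted_rate_le_mean\<close>).

Stationarity of the augmented tree is obtained without constructing a space of rooted trees. A step of the
walk, seen from its new position, is a permutation of the branches at the root followed by the
exchange \<open>reroot\<close> of the root with its child \<open>0\<close>. Both only permute the words that index the offspring
variables, and an i.i.d. family is invariant under injective reindexing. Together with the one-step
equation for the discounted sum, this determines its mean (\<open>discounted_agw_mean\<close>).
\<close>

section \<open>Offspring functions and the neighbours of a vertex\<close>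

definition branch :: "(nat list \<Rightarrow> nat) \<Rightarrow> nat \<Rightarrow> nat list \<Rightarrow> nat" where
  "branch c k = (\<lambda>w. c (k # w))"

definition kids :: "(nat list \<Rightarrow> nat) \<Rightarrow> nat list \<Rightarrow> nat list set" where
  "kids c x = (\<lambda>k. x @ [k]) ` {..<c x}"

lemma Nil_in_tree: "[] \<in> tree_of c"
  by (simp add: tree_of_def)

lemma snoc_in_tree: "x @ [k] \<in> tree_of c \<longleftrightarrow> x \<in> tree_of c \<and> k < c x"
  by (auto simp: tree_of_def nth_append less_Suc_eq)

lemma Cons_in_tree: "k # x \<in> tree_of c \<longleftrightarrow> k < c [] \<and> x \<in> tree_of (branch c k)"
  unfolding tree_of_def branch_def by (auto simp: All_less_Suc2)

lemma finite_kids: "finite (kids c x)"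
  by (simp add: kids_def)

lemma card_kids: "card (kids c x) = c x"
  unfolding kids_def by (subst card_image) (auto simp: inj_on_def)

lemma sum_kids: "(\<Sum>y\<in>kids c x. F y) = (\<Sum>k<c x. F (x @ [k]))"
  unfolding kids_def by (subst sum.reindex) (auto simp: inj_on_def)

lemma tree_nb_root: "tree_nb (tree_of c) [] = kids c []"
  unfolding tree_nb_def kids_def using snoc_in_tree[of "[]"] Nil_in_tree by auto

lemma tree_nb_snoc:
  assumes "x @ [j] \<in> tree_of c"
  shows "tree_nb (tree_of c) (x @ [j]) = insert x (kids c (x @ [j]))"
  using assms snoc_in_tree[of "x @ [j]"] snoc_in_tree[of x]
  unfolding tree_nb_def kids_def by auto

lemma kids_subset: "x \<in> tree_of c \<Longrightarrow> kids c x \<subseteq> tree_of c"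
  by (auto simp: kids_def snoc_in_tree)

lemma parent_notin_kids: "x \<notin> kids c (x @ ys)"
  by (auto simp: kids_def)

lemma
  assumes "x \<in> tree_of c" and "\<And>u. 1 \<le> c u"
  shows finite_tree_nb: "finite (tree_nb (tree_of c) x)"
    and tree_nb_nonempty: "tree_nb (tree_of c) x \<noteq> {}"
proof -
  have "kids c x \<noteq> {}" for x
    using assms(2)[of x] by (auto simp: kids_def lessThan_empty_iff)
  then show "finite (tree_nb (tree_of c) x)" "tree_nb (tree_of c) x \<noteq> {}"
    using assms(1) by (cases x rule: rev_cases; simp add: tree_nb_root tree_nb_snoc finite_kids)+
qed

lemma srw_support:
  assumes c: "\<And>u. 1 \<le> c u"
  shows "finite (set_pmf (srw (tree_nb (tree_of c)) [] t)) \<and>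
    set_pmf (srw (tree_nb (tree_of c)) [] t) \<subseteq> tree_of c \<inter> {x. length x \<le> t}"
proof (induction t)
  case 0
  then show ?case by (simp add: Nil_in_tree)
next
  case (Suc t)
  have nb: "set_pmf (pmf_of_set (tree_nb (tree_of c) x)) = tree_nb (tree_of c) x"
    "finite (tree_nb (tree_of c) x)" if "x \<in> set_pmf (srw (tree_nb (tree_of c)) [] t)" for x
    using that Suc finite_tree_nb[OF _ c] tree_nb_nonempty[OF _ c] by auto
  have "tree_nb (tree_of c) x \<subseteq> tree_of c \<inter> {y. length y \<le> Suc t}"
    if "x \<in> set_pmf (srw (tree_nb (tree_of c)) [] t)" for x
  proof -
    have "length x \<le> t" using that Suc by auto
    then show ?thesis by (auto simp: tree_nb_def)
  qed
  then show ?case using Suc nb by (auto simp: set_bind_pmf)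
qed

lemma srw_expectation_Suc:
  fixes F :: "nat list \<Rightarrow> real"
  assumes c: "\<And>u. 1 \<le> c u"
  shows "measure_pmf.expectation (srw (tree_nb (tree_of c)) [] (Suc t)) F =
    measure_pmf.expectation (srw (tree_nb (tree_of c)) [] t)
      (\<lambda>x. (\<Sum>y\<in>tree_nb (tree_of c) x. F y) / card (tree_nb (tree_of c) x))"
proof -
  let ?p = "srw (tree_nb (tree_of c)) [] t"
  have fin: "finite (set_pmf ?p)" and sub: "set_pmf ?p \<subseteq> tree_of c"
    using srw_support[of c, OF c] by auto
  have nb: "finite (tree_nb (tree_of c) x)" "tree_nb (tree_of c) x \<noteq> {}" if "x \<in> set_pmf ?p" for x
    using that sub finite_tree_nb[OF _ c] tree_nb_nonempty[OF _ c] by auto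
  show ?thesis
    unfolding srw.simps
    by (subst pmf_expectation_bind[OF fin])
      (auto simp: nb integral_pmf_of_set integral_measure_pmf[OF fin])
qed

lemma pmf_entropy_finite:
  assumes "finite (set_pmf p)"
  shows "pmf_entropy p = - (\<Sum>x\<in>set_pmf p. pmf p x * ln (pmf p x))"
proof -
  have "infsum (\<lambda>x. pmf p x * ln (pmf p x)) UNIV = infsum (\<lambda>x. pmf p x * ln (pmf p x)) (set_pmf p)"
    by (rule infsum_cong_neutral) (auto simp: set_pmf_iff)
  then show ?thesis using assms by (simp add: pmf_entropy_def)
qed

section \<open>Entropy of finitely supported laws\<close>

text \<open>Relative entropy with respect to the weights \<open>exp (- \<phi> x) / B\<close> is nonnegative; their
  total mass may be below one, which only helps.\<close>
lemma gibbs_inequality: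
  fixes \<phi> :: "'v \<Rightarrow> real"
  assumes fin: "finite (set_pmf p)"
    and B: "0 < B" "(\<Sum>x\<in>set_pmf p. exp (- \<phi> x)) \<le> B"
  shows "pmf_entropy p \<le> measure_pmf.expectation p \<phi> + ln B"
proof -
  have one: "(\<Sum>x\<in>set_pmf p. pmf p x) = 1"
    using fin by (simp add: sum_pmf_eq_1)
  have pt: "- (pmf p x * ln (pmf p x)) \<le> pmf p x * \<phi> x + pmf p x * ln B + (exp (- \<phi> x) / B - pmf p x)"
    if "x \<in> set_pmf p" for x
  proof -
    let ?q = "pmf p x"
    have q: "?q > 0" using that by (simp add: pmf_positive)
    have pos: "exp (- \<phi> x) / B / ?q > 0" using B q by simp
    have "ln (exp (- \<phi> x) / B / ?q) \<le> exp (- \<phi> x) / B / ?q - 1"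
      using ln_le_minus_one[OF pos] .
    moreover have "ln (exp (- \<phi> x) / B / ?q) = - \<phi> x - ln B - ln ?q"
      using B q by (subst ln_div, simp, simp, subst ln_div) auto
    ultimately have "?q * (- \<phi> x - ln B - ln ?q) \<le> ?q * (exp (- \<phi> x) / B / ?q - 1)"
      using q by (intro mult_left_mono) auto
    then show ?thesis using q by (simp add: algebra_simps)
  qed
  have "pmf_entropy p \<le> (\<Sum>x\<in>set_pmf p. pmf p x * \<phi> x + pmf p x * ln B + (exp (- \<phi> x) / B - pmf p x))"
    unfolding pmf_entropy_finite[OF fin] sum_negf[symmetric] by (rule sum_mono) (rule pt)
  also have "\<dots> = (\<Sum>x\<in>set_pmf p. pmf p x * \<phi> x) + ln B + ((\<Sum>x\<in>set_pmf p. exp (- \<phi> x)) / B - 1)"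
    by (simp add: sum.distrib sum_subtractf sum_divide_distrib one flip: sum_distrib_right)
  also have "\<dots> \<le> (\<Sum>x\<in>set_pmf p. pmf p x * \<phi> x) + ln B"
    using B by (simp add: divide_le_eq)
  also have "(\<Sum>x\<in>set_pmf p. pmf p x * \<phi> x) = measure_pmf.expectation p \<phi>"
    by (subst integral_measure_pmf[OF fin]) auto
  finally show ?thesis .
qed

section \<open>The nonbacktracking walk and the visibility measure\<close>

text \<open>Visibility measure of level \<open>n\<close>. The recursion descends from the root, the direction in which the
  law of the branches repeats the law of the tree; \<open>vis_snoc\<close> gives the recursion in the
  direction of the walk.\<close>
primrec vis :: "nat \<Rightarrow> (nat list \<Rightarrow> nat) \<Rightarrow> nat list pmf" where
  "vis 0 c = return_pmf []"
| "vis (Suc n) c =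
     bind_pmf (pmf_of_set {..<c []}) (\<lambda>k. map_pmf (Cons k) (vis n (branch c k)))"

lemma set_kids_index: "1 \<le> m \<Longrightarrow> set_pmf (pmf_of_set {..<m}) = {..<m::nat}"
  by (rule set_pmf_of_set) (auto simp: lessThan_empty_iff)

lemma pmf_vis_Cons:
  assumes "k < c []"
  shows "pmf (vis (Suc n) c) (k # v) = pmf (vis n (branch c k)) v / c []"
proof -
  have "pmf (vis (Suc n) c) (k # v) =
      (\<Sum>j<c []. pmf (map_pmf (Cons j) (vis n (branch c j))) (k # v)) / c []"
    using assms unfolding vis.simps
    by (subst pmf_bind, subst integral_pmf_of_set) (auto simp: lessThan_empty_iff)
  also have "(\<Sum>j<c []. pmf (map_pmf (Cons j) (vis n (branch c j))) (k # v)) =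
      (\<Sum>j<c []. if j = k then pmf (vis n (branch c k)) v else 0)"
  proof (rule sum.cong[OF refl])
    fix j
    show "pmf (map_pmf (Cons j) (vis n (branch c j))) (k # v) =
      (if j = k then pmf (vis n (branch c k)) v else 0)"
    proof (cases "j = k")
      case True
      have "pmf (map_pmf (Cons k) (vis n (branch c k))) (Cons k v) = pmf (vis n (branch c k)) v"
        by (rule pmf_map_inj') (auto simp: inj_on_def)
      with True show ?thesis by simp
    next
      case False
      then show ?thesis by (auto simp: pmf_eq_0_set_pmf)
    qed
  qed
  finally show ?thesis using assms by simp
qed

lemma pmf_vis:
  "x \<in> tree_of c \<Longrightarrow> pmf (vis (length x) c) x = (\<Prod>i<length x. 1 / real (c (take i x)))"
proof (induction x arbitrary: c)
  case (Cons k v)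
  then show ?case
    by (simp add: Cons_in_tree pmf_vis_Cons prod.lessThan_Suc_shift branch_def
        del: vis.simps prod.lessThan_Suc)
qed simp

lemma set_vis:
  assumes "\<And>u. 1 \<le> c u"
  shows "finite (set_pmf (vis n c)) \<and> set_pmf (vis n c) \<subseteq> tree_of c \<inter> {x. length x = n}"
  using assms
proof (induction n arbitrary: c)
  case (Suc n)
  have "1 \<le> branch c k u" for k u using Suc.prems by (simp add: branch_def)
  note IH = Suc.IH[OF this]
  show ?case using IH set_kids_index[OF Suc.prems]
    by (auto simp: Cons_in_tree set_bind_pmf subset_iff)
qed (simp add: Nil_in_tree)

text \<open>Splitting at the first step and splitting at the last step describe the same law. This links the
  walk, which appends letters to words, to recursion over the branches.\<close>
lemma vis_snoc:
  assumes "\<And>u. 1 \<le> c u"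
  shows "vis (Suc n) c = bind_pmf (vis n c) (\<lambda>x. pmf_of_set (kids c x))"
  using assms
proof (induction n arbitrary: c)
  case 0
  have "kids c [] = (\<lambda>k. [k]) ` {..<c []}" by (simp add: kids_def)
  moreover have "pmf_of_set ((\<lambda>k. [k]) ` {..<c []}) = map_pmf (\<lambda>k. [k]) (pmf_of_set {..<c []})"
    using 0[of "[]"] by (intro map_pmf_of_set_inj[symmetric]) (auto simp: inj_on_def lessThan_empty_iff)
  ultimately show ?case by (simp add: map_pmf_def bind_return_pmf)
next
  case (Suc n)
  have b: "1 \<le> branch c k u" for k u using Suc.prems by (simp add: branch_def)
  have k: "pmf_of_set (kids c (k # x)) = map_pmf (Cons k) (pmf_of_set (kids (branch c k) x))" for k x
  proof -
    have "kids c (k # x) = Cons k ` kids (branch c k) x"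
      by (auto simp: kids_def branch_def)
    moreover have "kids (branch c k) x \<noteq> {}"
      using b[of k x] by (auto simp: kids_def lessThan_empty_iff)
    ultimately show ?thesis
      by (simp add: map_pmf_of_set_inj finite_kids)
  qed
  have "vis (Suc (Suc n)) c = bind_pmf (pmf_of_set {..<c []})
      (\<lambda>k. map_pmf (Cons k) (vis (Suc n) (branch c k)))"
    by simp
  also have "\<dots> = bind_pmf (pmf_of_set {..<c []})
      (\<lambda>k. map_pmf (Cons k) (bind_pmf (vis n (branch c k)) (\<lambda>x. pmf_of_set (kids (branch c k) x))))"
    by (simp only: Suc.IH[OF b])
  also have "\<dots> = bind_pmf (vis (Suc n) c) (\<lambda>x. pmf_of_set (kids c x))"
    by (simp add: map_bind_pmf bind_map_pmf bind_assoc_pmf k)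
  finally show ?case .
qed

text \<open>A walk that has so far only moved downwards came from the parent, and excluding the parent
  leaves exactly the children.\<close>
lemma nbrw_step_eq:
  assumes c: "\<And>u. 1 \<le> c u"
  shows "nbrw_step (tree_nb (tree_of c)) [] t =
    bind_pmf (vis t c) (\<lambda>x. map_pmf (Pair x) (pmf_of_set (kids c x)))"
proof (induction t)
  case 0
  then show ?case by (simp add: tree_nb_root bind_return_pmf)
next
  case (Suc t)
  have k: "set_pmf (pmf_of_set (kids c x)) = kids c x" for x
    using c[of x] finite_kids by (intro set_pmf_of_set) (auto simp: kids_def lessThan_empty_iff)
  have "nbrw_step (tree_nb (tree_of c)) [] (Suc t) =
    bind_pmf (vis t c) (\<lambda>x. bind_pmf (pmf_of_set (kids c x))
      (\<lambda>y. map_pmf (Pair y) (pmf_of_set (tree_nb (tree_of c) y - {x}))))"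
    by (simp add: Suc bind_assoc_pmf bind_map_pmf)
  also have "\<dots> = bind_pmf (vis t c) (\<lambda>x. bind_pmf (pmf_of_set (kids c x))
      (\<lambda>y. map_pmf (Pair y) (pmf_of_set (kids c y))))"
  proof (intro bind_pmf_cong refl)
    fix x y assume x: "x \<in> set_pmf (vis t c)" and "y \<in> set_pmf (pmf_of_set (kids c x))"
    then have y: "y \<in> kids c x" by (simp add: k)
    have "x \<in> tree_of c" using x set_vis[of c t, OF c] by auto
    with y have "y \<in> tree_of c" using kids_subset by blast
    with y have "tree_nb (tree_of c) y - {x} = kids c y"
      by (auto simp: kids_def[of c x] tree_nb_snoc parent_notin_kids)
    then show "map_pmf (Pair y) (pmf_of_set (tree_nb (tree_of c) y - {x})) =
      map_pmf (Pair y) (pmf_of_set (kids c y))" by simp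
  qed
  also have "\<dots> = bind_pmf (vis (Suc t) c) (\<lambda>y. map_pmf (Pair y) (pmf_of_set (kids c y)))"
    by (simp add: vis_snoc[OF c] bind_assoc_pmf del: vis.simps)
  finally show ?case .
qed

lemma nbrw_eq_vis:
  assumes c: "\<And>u. 1 \<le> c u"
  shows "nbrw (tree_nb (tree_of c)) [] t = vis t c"
proof (cases t)
  case (Suc n)
  then show ?thesis
    by (simp add: nbrw_step_eq[OF c] map_bind_pmf map_pmf_comp vis_snoc[OF c] del: vis.simps)
qed simp

text \<open>Expected sum of \<open>f (c u)\<close> over the first \<open>n\<close> vertices \<open>u\<close> of a random ray from the root. With \<open>f = ln\<close>
  this is the entropy of \<open>vis n c\<close>; the general \<open>f\<close> allows truncation of the logarithm.\<close>
primrec vsum :: "(nat \<Rightarrow> real) \<Rightarrow> nat \<Rightarrow> (nat list \<Rightarrow> nat) \<Rightarrow> real" where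
  "vsum f 0 c = 0"
| "vsum f (Suc n) c = f (c []) + (\<Sum>k<c []. vsum f n (branch c k)) / c []"

lemma vsum_nonneg: "(\<And>z. 0 \<le> f z) \<Longrightarrow> 0 \<le> vsum f n c"
  by (induction n arbitrary: c) (auto intro!: add_nonneg_nonneg divide_nonneg_nonneg sum_nonneg)

lemma vsum_mono: "(\<And>z. f z \<le> g z) \<Longrightarrow> vsum f n c \<le> vsum g n c"
  by (induction n arbitrary: c) (auto intro!: add_mono divide_right_mono sum_mono)

lemma vsum_le:
  assumes f: "\<And>z. f z \<le> K" and K: "0 \<le> K"
  shows "vsum f n c \<le> real n * K"
proof (induction n arbitrary: c)
  case (Suc n)
  have "(\<Sum>k<c []. vsum f n (branch c k)) / real (c []) \<le> real (c []) * (real n * K) / real (c [])"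
    using sum_mono[of "{..<c []}" "\<lambda>k. vsum f n (branch c k)" "\<lambda>_. real n * K"] Suc
    by (intro divide_right_mono) auto
  also have "\<dots> \<le> real n * K" using K by simp
  finally show ?case using f[of "c []"] by (simp add: algebra_simps)
qed simp

text \<open>Chain rule: the branches are disjoint, so the entropy is that of the uniform choice of a branch plus
  the average entropy inside the branches.\<close>
lemma entropy_vis:
  assumes "\<And>u. 1 \<le> c u"
  shows "pmf_entropy (vis n c) = vsum (\<lambda>z. ln (real z)) n c"
  using assms
proof (induction n arbitrary: c)
  case 0
  have "pmf_entropy (return_pmf ([]::nat list)) = 0"
    by (subst pmf_entropy_finite) auto
  then show ?case by simp
next
  case (Suc n)
  let ?z = "c []"
  let ?p = "\<lambda>k. vis n (branch c k)"
  let ?S = "\<lambda>k. set_pmf (?p k)"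
  have z: "1 \<le> ?z" by (rule Suc.prems)
  have b: "1 \<le> branch c k u" for k u using Suc.prems by (simp add: branch_def)
  have fin: "finite (?S k)" for k using set_vis[OF b] by auto
  have supp: "set_pmf (vis (Suc n) c) = (\<Union>k<?z. Cons k ` ?S k)"
    using set_kids_index[OF z] by (auto simp: set_bind_pmf)
  have "pmf_entropy (vis (Suc n) c) =
      - (\<Sum>k<?z. \<Sum>x\<in>Cons k ` ?S k. pmf (vis (Suc n) c) x * ln (pmf (vis (Suc n) c) x))"
    using set_vis[of c "Suc n", OF Suc.prems]
    by (subst pmf_entropy_finite, blast, subst supp, subst sum.UNION_disjoint) (auto simp: fin)
  also have "\<dots> = - (\<Sum>k<?z. \<Sum>v\<in>?S k. pmf (?p k) v / ?z * ln (pmf (?p k) v / ?z))"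
    by (simp add: sum.reindex pmf_vis_Cons del: vis.simps)
  also have "\<dots> = (\<Sum>k<?z. (ln ?z + pmf_entropy (?p k)) / ?z)"
  proof (subst sum_negf[symmetric], rule sum.cong[OF refl])
    fix k
    have one: "(\<Sum>v\<in>?S k. pmf (?p k) v) = 1" using fin by (simp add: sum_pmf_eq_1)
    have "(\<Sum>v\<in>?S k. pmf (?p k) v / ?z * ln (pmf (?p k) v / ?z)) =
        (\<Sum>v\<in>?S k. pmf (?p k) v * ln (pmf (?p k) v) / ?z - pmf (?p k) v * (ln ?z / ?z))"
    proof (rule sum.cong[OF refl])
      fix v assume "v \<in> ?S k"
      then have split: "ln (pmf (?p k) v / ?z) = ln (pmf (?p k) v) - ln ?z"
        using z pmf_positive[of v "?p k"] by (subst ln_div) auto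
      show "pmf (?p k) v / ?z * ln (pmf (?p k) v / ?z) =
        pmf (?p k) v * ln (pmf (?p k) v) / ?z - pmf (?p k) v * (ln ?z / ?z)"
        unfolding split by (simp add: right_diff_distrib)
    qed
    also have "\<dots> = - pmf_entropy (?p k) / ?z - ln ?z / ?z"
      by (simp add: sum_subtractf one pmf_entropy_finite[OF fin]
          flip: sum_distrib_right sum_divide_distrib)
    finally show "- (\<Sum>v\<in>?S k. pmf (?p k) v / ?z * ln (pmf (?p k) v / ?z)) =
      (ln ?z + pmf_entropy (?p k)) / ?z" by (simp add: add_divide_distrib)
  qed
  also have "\<dots> = vsum (\<lambda>z. ln (real z)) (Suc n) c"
    using z by (simp add: Suc.IH[OF b] add_divide_distrib sum.distrib sum_divide_distrib)
  finally show ?case .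
qed

section \<open>An upper bound for the entropy of simple random walk\<close>

text \<open>Upper bound for the expected increment of \<open>pot\<close> at a vertex with \<open>z\<close> children.\<close>
definition drift :: "nat \<Rightarrow> real" where
  "drift z = real z / (real z + 1) * ln (real z)"

text \<open>The negative logarithm of the visibility measure, except that the factor of the root is dropped. The
  omission costs only the factor \<open>c []\<close> in \<open>exp_pot_le_vis\<close> and makes the increment at
  the root zero instead of \<open>ln (c [])\<close>, so that \<open>drift\<close> bounds the expected increment at every vertex.\<close>
definition pot :: "(nat list \<Rightarrow> nat) \<Rightarrow> nat list \<Rightarrow> real" where
  "pot c x = (\<Sum>i\<in>{1..<length x}. ln (real (c (take i x))))"

lemma drift_nonneg: "0 \<le> drift z"
  by (cases "z = 0") (auto simp: drift_def intro!: mult_nonneg_nonneg)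

lemma pot_root: "pot c [] = 0" "pot c [k] = 0"
  by (auto simp: pot_def)

lemma pot_snoc: "x \<noteq> [] \<Longrightarrow> pot c (x @ [k]) = pot c x + ln (real (c x))"
proof -
  assume "x \<noteq> []"
  then have "{1..<length (x @ [k])} = insert (length x) {1..<length x}" by (cases x) auto
  then show ?thesis by (simp add: pot_def)
qed

lemma pot_le_child:
  assumes "\<And>u. 1 \<le> c u"
  shows "pot c x \<le> pot c (x @ [k])"
  using assms[of x] by (cases "x = []") (auto simp: pot_root pot_snoc)

text \<open>A nonroot vertex with \<open>z\<close> children has \<open>z + 1\<close> neighbours; a step to a child costs \<open>ln z\<close>, and a step to
  the parent costs at most nothing.\<close>
lemma pot_drift:
  assumes x: "x \<in> tree_of c" and c: "\<And>u. 1 \<le> c u"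
  shows "(\<Sum>y\<in>tree_nb (tree_of c) x. pot c y) / card (tree_nb (tree_of c) x) \<le> pot c x + drift (c x)"
proof (cases x rule: rev_cases)
  case Nil
  then show ?thesis using drift_nonneg[of "c []"]
    by (simp add: tree_nb_root sum_kids pot_root)
next
  case (snoc p j)
  let ?z = "real (c x)"
  have "x \<noteq> []" using snoc by simp
  have p: "p \<notin> kids c x" using snoc parent_notin_kids by simp
  have nb: "tree_nb (tree_of c) x = insert p (kids c x)" using snoc x tree_nb_snoc by auto
  have "(\<Sum>y\<in>tree_nb (tree_of c) x. pot c y) = pot c p + ?z * (pot c x + ln ?z)"
    using p \<open>x \<noteq> []\<close> by (simp add: nb finite_kids sum_kids pot_snoc)
  moreover have "real (card (tree_nb (tree_of c) x)) = ?z + 1"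
    using p by (simp add: nb finite_kids card_kids)
  moreover have "pot c p \<le> pot c x" using pot_le_child[of c p j, OF c] snoc by simp
  then have "(pot c p + ?z * (pot c x + ln ?z)) / (?z + 1) \<le>
      (pot c x + ?z * (pot c x + ln ?z)) / (?z + 1)"
    by (intro divide_right_mono) auto
  moreover have "(pot c x + ?z * (pot c x + ln ?z)) / (?z + 1) = pot c x + drift (c x)"
    by (simp add: drift_def field_simps)
  ultimately show ?thesis by simp
qed

lemma exp_pot_le_vis:
  assumes x: "x \<in> tree_of c" and c: "\<And>u. 1 \<le> c u"
  shows "exp (- pot c x) \<le> c [] * pmf (vis (length x) c) x"
proof (cases "x = []")
  case True
  then show ?thesis using c[of "[]"] by (simp add: pot_root)
next
  case False
  have e: "{..<length x} = insert 0 {1..<length x}" using False by auto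
  have "exp (- pot c x) = (\<Prod>i\<in>{1..<length x}. exp (- ln (real (c (take i x)))))"
    unfolding pot_def sum_negf[symmetric] by (rule exp_sum) simp
  also have "\<dots> = (\<Prod>i\<in>{1..<length x}. 1 / real (c (take i x)))"
  proof (rule prod.cong[OF refl])
    fix i
    have "0 < real (c (take i x))" using c[of "take i x"] by linarith
    then show "exp (- ln (real (c (take i x)))) = 1 / real (c (take i x))"
      by (simp add: exp_minus field_simps)
  qed
  also have "\<dots> = c [] * pmf (vis (length x) c) x"
    using c[of "[]"] by (simp add: pmf_vis[OF x] e)
  finally show ?thesis by simp
qed

text \<open>Gibbs' inequality with potential \<open>pot\<close>: the walk is on one of the levels \<open>0, ..., t\<close> at time \<open>t\<close>, and
  the weights \<open>exp (- pot)\<close> of each level sum to at most \<open>c []\<close>.\<close>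
lemma srw_entropy_le:
  assumes c: "\<And>u. 1 \<le> c u"
  shows "pmf_entropy (srw (tree_nb (tree_of c)) [] t) \<le>
    (\<Sum>s<t. measure_pmf.expectation (srw (tree_nb (tree_of c)) [] s) (\<lambda>x. drift (c x)))
      + ln (real (c []) * (real t + 1))"
proof -
  let ?p = "srw (tree_nb (tree_of c)) []"
  have fin: "finite (set_pmf (?p t))" and sub: "set_pmf (?p t) \<subseteq> tree_of c" for t
    using srw_support[of c, OF c] by auto
  have len: "length x \<le> t" if "x \<in> set_pmf (?p t)" for x t
    using that srw_support[of c t, OF c] by auto
  have pos: "1 \<le> real (c [])" using c[of "[]"] by simp
  have "(\<Sum>x\<in>set_pmf (?p t). exp (- pot c x)) \<le>
      (\<Sum>x\<in>set_pmf (?p t). c [] * pmf (vis (length x) c) x)"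
    using sub exp_pot_le_vis[of _ c, OF _ c] by (intro sum_mono) auto
  also have "\<dots> = c [] * (\<Sum>n\<le>t. \<Sum>x\<in>{x\<in>set_pmf (?p t). length x = n}. pmf (vis (length x) c) x)"
    using len by (subst sum.group) (auto simp: fin sum_distrib_left)
  also have "\<dots> = c [] * (\<Sum>n\<le>t. \<Sum>x\<in>{x\<in>set_pmf (?p t). length x = n}. pmf (vis n c) x)"
    by (intro arg_cong2[where f = "(*)"] refl sum.cong) auto
  also have "\<dots> \<le> real (c []) * (\<Sum>n\<le>t. 1)"
  proof (intro mult_left_mono sum_mono)
    fix n
    have "finite {x\<in>set_pmf (?p t). length x = n}" using fin by simp
    then show "(\<Sum>x\<in>{x\<in>set_pmf (?p t). length x = n}. pmf (vis n c) x) \<le> 1"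
      by (simp add: measure_pmf.prob_le_1 flip: measure_measure_pmf_finite)
  qed auto
  finally have "(\<Sum>x\<in>set_pmf (?p t). exp (- pot c x)) \<le> real (c []) * (real t + 1)"
    by (simp add: add.commute)
  then have "pmf_entropy (?p t) \<le> measure_pmf.expectation (?p t) (pot c) + ln (real (c []) * (real t + 1))"
    using pos by (intro gibbs_inequality fin) auto
  moreover have "measure_pmf.expectation (?p t) (pot c) \<le>
      (\<Sum>s<t. measure_pmf.expectation (?p s) (\<lambda>x. drift (c x)))"
  proof (induction t)
    case (Suc t)
    have expectation: "measure_pmf.expectation (?p t) F = (\<Sum>x\<in>set_pmf (?p t). pmf (?p t) x * F x)"
      for F :: "nat list \<Rightarrow> real"
      by (subst integral_measure_pmf[OF fin]) auto
    have "measure_pmf.expectation (?p (Suc t)) (pot c) \<le>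
        measure_pmf.expectation (?p t) (\<lambda>x. pot c x + drift (c x))"
      unfolding srw_expectation_Suc[of c, OF c] expectation
      using sub pot_drift[of _ c, OF _ c] by (intro sum_mono mult_left_mono) auto
    also have "\<dots> = measure_pmf.expectation (?p t) (pot c) + measure_pmf.expectation (?p t) (\<lambda>x. drift (c x))"
      using fin by (simp add: integrable_measure_pmf_finite)
    finally show ?case using Suc by (simp del: srw.simps)
  qed (simp add: pot_root)
  ultimately show ?thesis by linarith
qed

section \<open>From averages to discounted sums\<close>

text \<open>The elementary half of the Abelian theorem: summation by parts turns a linear lower bound on partial
  sums into a lower bound on discounted sums.\<close>
lemma abel_lower_bound:
  fixes a :: "nat \<Rightarrow> real"
  assumes a: "\<And>s. 0 \<le> a s" and l: "0 \<le> l" "l < 1"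
    and A: "\<And>t. d * real t - C \<le> (\<Sum>s<t. a s)"
    and B: "\<And>n. (\<Sum>s<n. l ^ s * a s) \<le> B"
  shows "d \<le> (1 - l) * (B + C)"
proof -
  have parts: "(\<Sum>s<n. l ^ s * a s) = (1 - l) * (\<Sum>r<n. l ^ r * (\<Sum>s<Suc r. a s)) + l ^ n * (\<Sum>s<n. a s)" for n
    by (induction n) (auto simp: algebra_simps)
  have "(1 - l) * (\<Sum>r<n. d * (real (Suc r) * l ^ r) - C * l ^ r) \<le> B" for n
  proof -
    have "(1 - l) * (\<Sum>r<n. d * (real (Suc r) * l ^ r) - C * l ^ r) \<le>
        (1 - l) * (\<Sum>r<n. l ^ r * (\<Sum>s<Suc r. a s))"
    proof (intro mult_left_mono sum_mono)
      fix r
      have "l ^ r * (d * real (Suc r) - C) \<le> l ^ r * (\<Sum>s<Suc r. a s)"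
        using l A[of "Suc r"] by (intro mult_left_mono) auto
      then show "d * (real (Suc r) * l ^ r) - C * l ^ r \<le> l ^ r * (\<Sum>s<Suc r. a s)"
        by (simp add: algebra_simps)
    qed (use l in auto)
    also have "\<dots> \<le> (\<Sum>s<n. l ^ s * a s)"
      unfolding parts using l a by (simp add: sum_nonneg)
    finally show ?thesis using B[of n] by linarith
  qed
  moreover have "(\<lambda>r. d * (real (Suc r) * l ^ r) - C * l ^ r) sums (d * (1 / (1 - l)\<^sup>2) - C * (1 / (1 - l)))"
    using l geometric_deriv_sums[of l] geometric_sums[of l] by (intro sums_diff sums_mult) auto
  then have "(\<lambda>n. (1 - l) * (\<Sum>r<n. d * (real (Suc r) * l ^ r) - C * l ^ r)) \<longlonglongrightarrow>
      (1 - l) * (d * (1 / (1 - l)\<^sup>2) - C * (1 / (1 - l)))"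
    unfolding sums_def by (intro tendsto_mult tendsto_const)
  ultimately have "(1 - l) * (d * (1 / (1 - l)\<^sup>2) - C * (1 / (1 - l))) \<le> B"
    by (meson LIMSEQ_le_const2)
  moreover have "(1 - l) * (d * (1 / (1 - l)\<^sup>2) - C * (1 / (1 - l))) = d / (1 - l) - C"
  proof -
    have "m * (d * (1 / m\<^sup>2) - C * (1 / m)) = d / m - C" if "m \<noteq> 0" for m :: real
      using that by (simp add: field_simps power2_eq_square)
    then show ?thesis using l by simp
  qed
  ultimately have "d / (1 - l) \<le> B + C" by linarith
  then show ?thesis using l by (simp add: pos_divide_le_eq mult.commute)
qed

section \<open>Discounted functionals of a branch\<close>

text \<open>Attach a parent to the root of the tree of \<open>c\<close>, so that a vertex with \<open>z\<close> children has degree \<open>z + 1\<close>.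
  For the walk started at that root, \<open>hit l c\<close> is the generating function at \<open>l\<close> of the hitting time of the
  parent, and \<open>occ l f c\<close> is the expected discounted sum of \<open>f\<close> before that time. First-step
  analysis gives the recursions \<open>hit_rec\<close> and \<open>occ_rec\<close>, which carry all later arguments. The functionals are
  defined as limits of the monotone iteration of these recursions, a form in which measurability in \<open>c\<close> and
  monotonicity in \<open>f\<close> are immediate.\<close>
primrec hit_n :: "real \<Rightarrow> nat \<Rightarrow> (nat list \<Rightarrow> nat) \<Rightarrow> real" where
  "hit_n l 0 c = 0"
| "hit_n l (Suc n) c =
     l / (real (c []) + 1) / (1 - l / (real (c []) + 1) * (\<Sum>k<c []. hit_n l n (branch c k)))"

definition hit :: "real \<Rightarrow> (nat list \<Rightarrow> nat) \<Rightarrow> real" where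
  "hit l c = (SUP n. hit_n l n c)"

text \<open>The common denominator of both recursions: one minus the discounted weight of the excursions from
  the root into its branches.\<close>
definition esc :: "real \<Rightarrow> (nat list \<Rightarrow> nat) \<Rightarrow> real" where
  "esc l c = 1 - l / (real (c []) + 1) * (\<Sum>k<c []. hit l (branch c k))"

primrec occ_n :: "real \<Rightarrow> (nat \<Rightarrow> real) \<Rightarrow> nat \<Rightarrow> (nat list \<Rightarrow> nat) \<Rightarrow> real" where
  "occ_n l f 0 c = 0"
| "occ_n l f (Suc n) c =
     (f (c []) + l / (real (c []) + 1) * (\<Sum>k<c []. occ_n l f n (branch c k))) / esc l c"

definition occ :: "real \<Rightarrow> (nat \<Rightarrow> real) \<Rightarrow> (nat list \<Rightarrow> nat) \<Rightarrow> real" where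
  "occ l f c = (SUP n. occ_n l f n c)"

lemma esc_ge:
  fixes h :: "nat \<Rightarrow> real"
  assumes l: "0 \<le> l" "l \<le> 1" and h: "\<And>k. h k \<le> l"
  shows "1 / (real z + 1) \<le> 1 - l / (real z + 1) * (\<Sum>k<z. h k)"
proof -
  have "(\<Sum>k<z. h k) \<le> real z * l" using sum_mono[of "{..<z}" h "\<lambda>_. l"] h by simp
  then have "l * (\<Sum>k<z. h k) \<le> l * (real z * l)" using l by (intro mult_left_mono)
  also have "\<dots> = l * l * real z" by simp
  also have "\<dots> \<le> 1 * real z" using l by (intro mult_right_mono mult_le_one) auto
  finally show ?thesis by (simp add: field_simps)
qed

lemma hit_step_le:
  fixes h :: "nat \<Rightarrow> real"
  assumes l: "0 \<le> l" "l \<le> 1" and h: "\<And>k. h k \<le> l"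
  shows "l / (real z + 1) / (1 - l / (real z + 1) * (\<Sum>k<z. h k)) \<le> l"
proof -
  let ?D = "1 - l / (real z + 1) * (\<Sum>k<z. h k)"
  have D: "1 / (real z + 1) \<le> ?D" by (rule esc_ge[of l h z]) (use assms in auto)
  have "0 < 1 / (real z + 1)" by simp
  with D have "0 < ?D" by linarith
  moreover have "l / (real z + 1) \<le> l * ?D" using mult_left_mono[OF D l(1)] by simp
  ultimately show ?thesis by (simp only: pos_divide_le_eq)
qed

lemma hit_n_bounds:
  assumes l: "0 \<le> l" "l \<le> 1"
  shows "0 \<le> hit_n l n c \<and> hit_n l n c \<le> l"
proof (induction n arbitrary: c)
  case (Suc n)
  have "0 < 1 / (real (c []) + 1)" by simp
  also have "\<dots> \<le> 1 - l / (real (c []) + 1) * (\<Sum>k<c []. hit_n l n (branch c k))"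
    by (rule esc_ge) (use l Suc in auto)
  finally have "0 \<le> hit_n l (Suc n) c"
    using l by (simp only: hit_n.simps) (intro divide_nonneg_pos; simp)
  moreover have "hit_n l (Suc n) c \<le> l"
    unfolding hit_n.simps by (rule hit_step_le) (use l Suc in auto)
  ultimately show ?case by blast
qed (use l in auto)

lemma hit_n_mono:
  assumes l: "0 \<le> l" "l \<le> 1"
  shows "hit_n l n c \<le> hit_n l (Suc n) c"
proof (induction n arbitrary: c)
  case 0
  then show ?case using hit_n_bounds[OF l, of 1 c] by simp
next
  case (Suc n)
  have "0 < 1 / (real (c []) + 1)" by simp
  also have "\<dots> \<le> 1 - l / (real (c []) + 1) * (\<Sum>k<c []. hit_n l (Suc n) (branch c k))"
    by (rule esc_ge[OF l]) (use hit_n_bounds[OF l] in blast)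
  finally have pos: "0 < 1 - l / (real (c []) + 1) * (\<Sum>k<c []. hit_n l (Suc n) (branch c k))" .
  have "l / (real (c []) + 1) * (\<Sum>k<c []. hit_n l n (branch c k)) \<le>
      l / (real (c []) + 1) * (\<Sum>k<c []. hit_n l (Suc n) (branch c k))"
    using l Suc by (intro mult_left_mono sum_mono) auto
  then have le: "1 - l / (real (c []) + 1) * (\<Sum>k<c []. hit_n l (Suc n) (branch c k)) \<le>
      1 - l / (real (c []) + 1) * (\<Sum>k<c []. hit_n l n (branch c k))"
    by (rule diff_left_mono)
  show ?case
    by (subst (1 2) hit_n.simps(2), rule divide_left_mono[OF le])
      (use l in simp, rule mult_pos_pos[OF less_le_trans[OF pos le] pos])
qed

lemma hit_n_tendsto:
  assumes l: "0 \<le> l" "l \<le> 1"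
  shows "(\<lambda>n. hit_n l n c) \<longlonglongrightarrow> hit l c"
  unfolding hit_def using hit_n_mono[OF l] hit_n_bounds[OF l]
  by (intro LIMSEQ_incseq_SUP incseq_SucI bdd_aboveI2[where M = l]) auto

lemma hit_bounds:
  assumes l: "0 \<le> l" "l \<le> 1"
  shows "0 \<le> hit l c" "hit l c \<le> l"
  using hit_n_tendsto[OF l, of c] hit_n_bounds[OF l]
  by (auto intro: LIMSEQ_le_const LIMSEQ_le_const2)

lemma esc_pos:
  assumes l: "0 \<le> l" "l \<le> 1"
  shows "0 < esc l c"
proof -
  have "0 < 1 / (real (c []) + 1)" by simp
  also have "\<dots> \<le> esc l c" unfolding esc_def by (rule esc_ge) (use l hit_bounds[OF l] in auto)
  finally show ?thesis .
qed

lemma hit_rec: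
  assumes l: "0 \<le> l" "l \<le> 1"
  shows "hit l c * esc l c = l / (real (c []) + 1)"
proof -
  have "(\<lambda>n. hit_n l (Suc n) c) \<longlonglongrightarrow> l / (real (c []) + 1) / esc l c"
    unfolding esc_def hit_n.simps using esc_pos[OF l, of c]
    by (intro tendsto_intros hit_n_tendsto l) (auto simp: esc_def)
  moreover have "(\<lambda>n. hit_n l (Suc n) c) \<longlonglongrightarrow> hit l c"
    using hit_n_tendsto[OF l] by (rule LIMSEQ_Suc)
  ultimately have "hit l c = l / (real (c []) + 1) / esc l c" by (rule LIMSEQ_unique[rotated])
  then show ?thesis using esc_pos[OF l, of c] by simp
qed

text \<open>The factor \<open>1 - hit l c\<close> cannot be dropped from the induction hypothesis: it is what makes the bound
  \<open>K / (1 - l)\<close>, the discounted sum of the constant \<open>K\<close> over all times, reproduce itself.\<close>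
lemma occ_n_bounds:
  assumes l: "0 \<le> l" "l < 1" and f: "\<And>z. 0 \<le> f z" "\<And>z. f z \<le> K"
  shows "0 \<le> occ_n l f n c \<and> occ_n l f n c \<le> K / (1 - l) * (1 - hit l c)"
proof (induction n arbitrary: c)
  case 0
  have "0 \<le> K" using f(1)[of 0] f(2)[of 0] by linarith
  then show ?case using l hit_bounds[of l c] by simp
next
  case (Suc n)
  let ?q = "l / (real (c []) + 1)"
  let ?H = "\<Sum>k<c []. hit l (branch c k)"
  let ?b = "K / (1 - l)"
  have q: "0 \<le> ?q" "?q * real (c []) = l - ?q" using l by (auto simp: field_simps)
  have "?b * (1 - l) = K" using l by simp
  then have b: "K = ?b - ?b * l" by (simp only: right_diff_distrib mult_1_right)
  have e: "0 < esc l c" using esc_pos l by simp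
  have h: "hit l c * esc l c = ?q" using hit_rec l by simp
  have "f (c []) + ?q * (\<Sum>k<c []. occ_n l f n (branch c k)) \<le> K + ?q * (\<Sum>k<c []. ?b * (1 - hit l (branch c k)))"
    using f Suc q by (intro add_mono mult_left_mono sum_mono) auto
  also have "\<dots> = K + ?b * (?q * real (c [])) - ?b * (?q * ?H)"
  proof -
    have "K + q * (\<Sum>k<c []. b * (1 - hit l (branch c k))) = K + b * (q * real (c [])) - b * (q * ?H)"
      for q b :: real
      unfolding sum_distrib_left[symmetric] sum_subtractf by (simp add: right_diff_distrib mult.left_commute)
    then show ?thesis .
  qed
  also have "\<dots> = ?b * (1 - hit l c) * esc l c"
  proof -
    have "K + B * (l - q) - B * Q = B * (1 - h) * e"
      if "K = B - B * l" "h * e = q" "Q = 1 - e" for B q Q h e :: real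
      using that by algebra
    moreover have "?q * ?H = 1 - esc l c" by (simp add: esc_def)
    ultimately show ?thesis unfolding q(2) using b h by blast
  qed
  finally have "occ_n l f (Suc n) c \<le> ?b * (1 - hit l c)"
    using e by (simp add: divide_le_eq)
  moreover have "0 \<le> occ_n l f (Suc n) c"
    using f q e Suc l by (auto intro!: divide_nonneg_pos add_nonneg_nonneg mult_nonneg_nonneg sum_nonneg)
  ultimately show ?case by blast
qed

lemma occ_n_mono:
  assumes l: "0 \<le> l" "l < 1" and f: "\<And>z. 0 \<le> f z" "\<And>z. f z \<le> K"
  shows "occ_n l f n c \<le> occ_n l f (Suc n) c"
proof (induction n arbitrary: c)
  case 0
  then show ?case using occ_n_bounds[of l f K 1, OF assms] by simp
next
  case (Suc n)
  have "l / (real (c []) + 1) * (\<Sum>k<c []. occ_n l f n (branch c k)) \<le>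
      l / (real (c []) + 1) * (\<Sum>k<c []. occ_n l f (Suc n) (branch c k))"
    using l Suc by (intro mult_left_mono sum_mono) auto
  then show ?case
    using esc_pos[of l c] l by (subst (1 2) occ_n.simps(2)) (intro divide_right_mono; auto)
qed

lemma occ_n_tendsto:
  assumes l: "0 \<le> l" "l < 1" and f: "\<And>z. 0 \<le> f z" "\<And>z. f z \<le> K"
  shows "(\<lambda>n. occ_n l f n c) \<longlonglongrightarrow> occ l f c"
  unfolding occ_def using occ_n_mono[of l f K, OF assms] occ_n_bounds[of l f K, OF assms]
  by (intro LIMSEQ_incseq_SUP incseq_SucI bdd_aboveI2[where M = "K / (1 - l) * (1 - hit l c)"]) auto

lemma occ_bounds:
  assumes l: "0 \<le> l" "l < 1" and f: "\<And>z. 0 \<le> f z" "\<And>z. f z \<le> K"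
  shows "0 \<le> occ l f c" "occ l f c \<le> K / (1 - l) * (1 - hit l c)"
  using occ_n_tendsto[of l f K c, OF assms] occ_n_bounds[of l f K, OF assms]
  by (auto intro: LIMSEQ_le_const LIMSEQ_le_const2)

lemma occ_rec:
  assumes l: "0 \<le> l" "l < 1" and f: "\<And>z. 0 \<le> f z" "\<And>z. f z \<le> K"
  shows "occ l f c * esc l c = f (c []) + l / (real (c []) + 1) * (\<Sum>k<c []. occ l f (branch c k))"
proof -
  have "(\<lambda>n. occ_n l f (Suc n) c) \<longlonglongrightarrow>
      (f (c []) + l / (real (c []) + 1) * (\<Sum>k<c []. occ l f (branch c k))) / esc l c"
    unfolding occ_n.simps using esc_pos[of l c] l
    by (intro tendsto_intros occ_n_tendsto[of l f K, OF assms]) auto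
  moreover have "(\<lambda>n. occ_n l f (Suc n) c) \<longlonglongrightarrow> occ l f c"
    using occ_n_tendsto[of l f K, OF assms] by (rule LIMSEQ_Suc)
  ultimately have "occ l f c = (f (c []) + l / (real (c []) + 1) * (\<Sum>k<c []. occ l f (branch c k))) / esc l c"
    by (rule LIMSEQ_unique[rotated])
  then show ?thesis using esc_pos[of l c] l by simp
qed

lemma occ_mono:
  assumes l: "0 \<le> l" "l < 1" and f: "\<And>z. 0 \<le> f z" "\<And>z. f z \<le> g z" and g: "\<And>z. g z \<le> K"
  shows "occ l f c \<le> occ l g c"
proof -
  have g0: "0 \<le> g z" and fK: "f z \<le> K" for z
    using f[of z] g[of z] by linarith+
  have "occ_n l f n c \<le> occ_n l g n c" for n
  proof (induction n arbitrary: c)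
    case (Suc n)
    then show ?case using esc_pos[of l c] l f
      by (auto intro!: divide_right_mono add_mono mult_left_mono sum_mono)
  qed simp
  then show ?thesis
    using occ_n_tendsto[of l f K, OF l f(1) fK] occ_n_tendsto[of l g K, OF l g0 g]
    by (meson LIMSEQ_le)
qed

section \<open>Discounted sums on Galton--Watson and augmented trees\<close>

definition subtree :: "(nat list \<Rightarrow> nat) \<Rightarrow> nat list \<Rightarrow> nat list \<Rightarrow> nat" where
  "subtree c x = (\<lambda>w. c (x @ w))"

lemma branch_subtree: "branch (subtree c x) k = subtree c (x @ [k])"
  by (simp add: branch_def subtree_def)

text \<open>The discounted sum of \<open>f\<close> along simple random walk from the root, obtained by decomposing the path into
  excursions into the branches.\<close>
definition gw_value :: "real \<Rightarrow> (nat \<Rightarrow> real) \<Rightarrow> (nat list \<Rightarrow> nat) \<Rightarrow> real" where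
  "gw_value l f c =
     (f (c []) + l / real (c []) * (\<Sum>k<c []. occ l f (branch c k))) /
     (1 - l / real (c []) * (\<Sum>k<c []. hit l (branch c k)))"

text \<open>The same quantity on the augmented tree, whose root has the \<open>c [] + 1\<close> children \<open>0, ..., c []\<close>. The
  value of \<open>f\<close> at the root is still \<open>f (c [])\<close>: at every vertex the argument of \<open>f\<close> is the
  degree minus one.\<close>
definition agw_value :: "real \<Rightarrow> (nat \<Rightarrow> real) \<Rightarrow> (nat list \<Rightarrow> nat) \<Rightarrow> real" where
  "agw_value l f c =
     (f (c []) + l / (real (c []) + 1) * (\<Sum>k\<le>c []. occ l f (branch c k))) /
     (1 - l / (real (c []) + 1) * (\<Sum>k\<le>c []. hit l (branch c k)))"

text \<open>The discounted sum for the walk started at \<open>x\<close>, when \<open>r\<close> is the value at the root: from a child, the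
  walk collects \<open>occ\<close> until it steps to the parent, which happens with discounted weight \<open>hit\<close>.\<close>
primrec vertex_value ::
  "real \<Rightarrow> (nat \<Rightarrow> real) \<Rightarrow> nat list \<Rightarrow> (nat list \<Rightarrow> nat) \<Rightarrow> real \<Rightarrow> real" where
  "vertex_value l f [] c r = r"
| "vertex_value l f (k # w) c r =
     vertex_value l f w (branch c k) (occ l f (branch c k) + hit l (branch c k) * r)"

lemma vertex_value_snoc:
  "vertex_value l f (x @ [k]) c r =
     occ l f (subtree c (x @ [k])) + hit l (subtree c (x @ [k])) * vertex_value l f x c r"
proof (induction x arbitrary: c r)
  case Nil
  have "branch c k = subtree c [k]" by (simp add: branch_def subtree_def)
  then show ?case by simp
next
  case (Cons j x)
  have "subtree (branch c j) (x @ [k]) = subtree c (j # x @ [k])"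
    by (simp add: branch_def subtree_def)
  with Cons show ?case by simp
qed

lemma average_hit_le:
  fixes h :: "nat \<Rightarrow> real"
  assumes "0 \<le> l" "l < 1" "finite A" "A \<noteq> {}" and h: "\<And>k. h k \<le> 1"
  shows "0 < 1 - l / real (card A) * (\<Sum>k\<in>A. h k)"
proof -
  have c: "0 < real (card A)" using assms by (simp add: card_gt_0_iff)
  have "(\<Sum>k\<in>A. h k) \<le> real (card A)" using sum_mono[of A h "\<lambda>_. 1"] h by simp
  then have "l / real (card A) * (\<Sum>k\<in>A. h k) \<le> l / real (card A) * real (card A)"
    using assms by (intro mult_left_mono) auto
  also have "\<dots> = l" using c by simp
  finally show ?thesis using assms(2) by linarith
qed

lemma hit_unit:
  assumes "0 \<le> l" "l < 1"
  shows "0 \<le> hit l c" "hit l c \<le> l" "hit l c \<le> 1"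
  using hit_bounds[of l c] assms by auto

lemma gw_denominator:
  assumes l: "0 \<le> l" "l < 1" and c: "1 \<le> c []"
  shows "0 < 1 - l / real (c []) * (\<Sum>k<c []. hit l (branch c k))"
  using average_hit_le[of l "{..<c []}" "\<lambda>k. hit l (branch c k)"] l c hit_unit[OF l]
  by (auto simp: lessThan_empty_iff)

lemma agw_denominator:
  assumes l: "0 \<le> l" "l < 1"
  shows "0 < 1 - l / (real (c []) + 1) * (\<Sum>k\<le>c []. hit l (branch c k))"
  using average_hit_le[of l "{..c []}" "\<lambda>k. hit l (branch c k)"] l hit_unit[OF l]
  by (auto simp: add.commute)

context
  fixes l K :: real and f :: "nat \<Rightarrow> real"
  assumes l: "0 \<le> l" "l < 1" and f: "\<And>z. 0 \<le> f z" "\<And>z. f z \<le> K"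
begin

lemma occ_nonneg: "0 \<le> occ l f c"
  using occ_bounds(1)[of l f K c] l f by blast

lemma gw_value_nonneg: "1 \<le> c [] \<Longrightarrow> 0 \<le> gw_value l f c"
  unfolding gw_value_def using gw_denominator[OF l] f l occ_nonneg
  by (intro divide_nonneg_pos add_nonneg_nonneg mult_nonneg_nonneg sum_nonneg) auto

lemma vertex_value_nonneg: "0 \<le> r \<Longrightarrow> 0 \<le> vertex_value l f x c r"
  by (induction x arbitrary: c r) (auto simp: hit_unit[OF l] occ_nonneg)

text \<open>The values satisfy the resolvent equation of simple random walk, root and other vertices alike.\<close>
lemma vertex_value_resolvent:
  assumes x: "x \<in> tree_of c" and c: "\<And>u. 1 \<le> c u"
  defines "V \<equiv> \<lambda>x. vertex_value l f x c (gw_value l f c)"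
  shows "V x = f (c x) + l * ((\<Sum>y\<in>tree_nb (tree_of c) x. V y) / card (tree_nb (tree_of c) x))"
proof (cases x rule: rev_cases)
  case Nil
  let ?R = "gw_value l f c" and ?z = "real (c [])"
  let ?U = "\<Sum>k<c []. occ l f (branch c k)" and ?H = "\<Sum>k<c []. hit l (branch c k)"
  have "?R * (1 - l / ?z * ?H) = f (c []) + l / ?z * ?U"
    using gw_denominator[OF l, of c] c[of "[]"] by (simp add: gw_value_def)
  moreover have "(\<Sum>y\<in>kids c []. V y) = ?U + ?H * ?R"
    by (simp add: sum_kids V_def sum.distrib sum_distrib_right)
  moreover have "?R = f (c []) + l * ((U + H * ?R) / ?z)" if "?R * (1 - l / ?z * H) = f (c []) + l / ?z * U" for U H
    using that by (simp add: algebra_simps add_divide_distrib)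
  ultimately have "?R = f (c []) + l * ((\<Sum>y\<in>kids c []. V y) / ?z)" by simp
  then show ?thesis using Nil by (simp add: tree_nb_root card_kids) (simp add: V_def)
next
  case (snoc p j)
  let ?z = "real (c x)" and ?s = "subtree c x"
  let ?U = "\<Sum>k<c x. occ l f (branch ?s k)" and ?H = "\<Sum>k<c x. hit l (branch ?s k)"
  have s: "?s [] = c x" by (simp add: subtree_def)
  have pk: "p \<notin> kids c x" using snoc parent_notin_kids by simp
  have nb: "tree_nb (tree_of c) x = insert p (kids c x)" using snoc x tree_nb_snoc by auto
  have card: "real (card (tree_nb (tree_of c) x)) = ?z + 1"
    using pk by (simp add: nb finite_kids card_kids)
  have Vx: "V x = occ l f ?s + hit l ?s * V p"
    unfolding V_def snoc vertex_value_snoc ..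
  have "(\<Sum>y\<in>tree_nb (tree_of c) x. V y) = V p + (\<Sum>k<c x. V (x @ [k]))"
    using pk by (simp add: nb finite_kids sum_kids)
  also have "(\<Sum>k<c x. V (x @ [k])) = ?U + ?H * V x"
    by (simp add: V_def vertex_value_snoc branch_subtree sum.distrib sum_distrib_right)
  finally have sum: "(\<Sum>y\<in>tree_nb (tree_of c) x. V y) = V p + (?U + ?H * V x)" .
  have "hit l ?s * esc l ?s = l / (?z + 1)" using hit_rec[of l ?s] l s by simp
  moreover have "occ l f ?s * esc l ?s = f (c x) + l / (?z + 1) * ?U"
    using occ_rec[of l f K ?s] l f s by simp
  moreover have "esc l ?s = 1 - l / (?z + 1) * ?H" using s by (simp add: esc_def)
  moreover have "v = F + q * (w + (U + H * v))"
    if "v = u + h * w" "h * e = q" "u * e = F + q * U" "e = 1 - q * H" for u h w q F e U H v :: real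
    using that by algebra
  ultimately have "V x = f (c x) + l / (?z + 1) * (V p + (?U + ?H * V x))"
    using Vx by metis
  then show ?thesis unfolding sum card by simp
qed

text \<open>Iterating the resolvent equation \<open>n\<close> times leaves a nonnegative remainder.\<close>
lemma discounted_sum_le_gw_value:
  assumes c: "\<And>u. 1 \<le> c u"
  shows "(\<Sum>s<n. l ^ s * measure_pmf.expectation (srw (tree_nb (tree_of c)) [] s) (\<lambda>x. f (c x)))
    \<le> gw_value l f c"
proof -
  let ?p = "srw (tree_nb (tree_of c)) []"
  let ?V = "\<lambda>x. vertex_value l f x c (gw_value l f c)"
  have fin: "finite (set_pmf (?p t))" and sub: "set_pmf (?p t) \<subseteq> tree_of c" for t
    using srw_support[of c, OF c] by auto
  have expectation: "measure_pmf.expectation (?p t) F = (\<Sum>x\<in>set_pmf (?p t). pmf (?p t) x * F x)"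
    for F :: "nat list \<Rightarrow> real" and t
    by (subst integral_measure_pmf[OF fin]) auto
  have step: "measure_pmf.expectation (?p t) ?V =
      measure_pmf.expectation (?p t) (\<lambda>x. f (c x)) + l * measure_pmf.expectation (?p (Suc t)) ?V" for t
  proof -
    have "measure_pmf.expectation (?p t) ?V = measure_pmf.expectation (?p t)
        (\<lambda>x. f (c x) + l * ((\<Sum>y\<in>tree_nb (tree_of c) x. ?V y) / card (tree_nb (tree_of c) x)))"
      unfolding expectation
      by (intro sum.cong refl, subst vertex_value_resolvent[OF _ c]) (use sub in auto)
    also have "\<dots> = measure_pmf.expectation (?p t) (\<lambda>x. f (c x)) + l * measure_pmf.expectation (?p (Suc t)) ?V"
    proof -
      have "measure_pmf.expectation (?p t) (\<lambda>x. A x + l * B x) =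
          measure_pmf.expectation (?p t) A + l * measure_pmf.expectation (?p t) B"
        for A B :: "nat list \<Rightarrow> real"
        using fin by (simp add: integrable_measure_pmf_finite)
      then show ?thesis unfolding srw_expectation_Suc[of c, OF c] .
    qed
    finally show ?thesis .
  qed
  have "gw_value l f c = (\<Sum>s<n. l ^ s * measure_pmf.expectation (?p s) (\<lambda>x. f (c x))) +
      l ^ n * measure_pmf.expectation (?p n) ?V"
  proof (induction n)
    case (Suc n)
    also have "(\<Sum>s<n. l ^ s * measure_pmf.expectation (?p s) (\<lambda>x. f (c x))) +
        l ^ n * measure_pmf.expectation (?p n) ?V =
      (\<Sum>s<Suc n. l ^ s * measure_pmf.expectation (?p s) (\<lambda>x. f (c x))) +
        l ^ Suc n * measure_pmf.expectation (?p (Suc n)) ?V"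
      unfolding step[of n] by (simp add: algebra_simps del: srw.simps)
    finally show ?case .
  qed simp
  moreover have "0 \<le> l ^ n * measure_pmf.expectation (?p n) ?V"
    using vertex_value_nonneg gw_value_nonneg c l
    by (intro mult_nonneg_nonneg integral_nonneg_AE) auto
  ultimately show ?thesis by linarith
qed

end

text \<open>Reindexings of words, applied to offspring functions by composition: \<open>c \<circ> prune i\<close> is the augmented tree of
  \<open>c\<close> without the branch at its child \<open>i\<close>, a tree whose root has \<open>c []\<close> children; \<open>c \<circ> swap i\<close> exchanges
  the branches at \<open>0\<close> and \<open>i\<close>; and \<open>c \<circ> reroot\<close> is the augmented tree seen from the child \<open>0\<close>, whose own
  child \<open>0\<close> is then the old root.\<close>
definition prune :: "nat \<Rightarrow> nat list \<Rightarrow> nat list" where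
  "prune i w = (case w of [] \<Rightarrow> [] | k # v \<Rightarrow> (if k < i then k else Suc k) # v)"

definition swap :: "nat \<Rightarrow> nat list \<Rightarrow> nat list" where
  "swap i w = (case w of [] \<Rightarrow> [] | k # v \<Rightarrow> Transposition.transpose 0 i k # v)"

definition reroot :: "nat list \<Rightarrow> nat list" where
  "reroot w = (case w of [] \<Rightarrow> [0]
     | 0 # v \<Rightarrow> (case v of [] \<Rightarrow> [] | k # v' \<Rightarrow> Suc k # v')
     | Suc k # v \<Rightarrow> 0 # k # v)"

lemma prune_Nil [simp]: "prune i [] = []" and swap_Nil [simp]: "swap i [] = []"
  by (auto simp: prune_def swap_def)

lemma inj_prune: "inj (prune i)"
  by (auto simp: inj_def prune_def split: list.splits if_splits)

lemma swap_swap: "swap i (swap i w) = w"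
  by (auto simp: swap_def split: list.splits)

lemma reroot_reroot: "reroot (reroot w) = w"
  by (auto simp: reroot_def split: list.splits nat.splits)

lemma inj_swap: "inj (swap i)"
  by (metis injI swap_swap)

lemma inj_reroot: "inj reroot"
  by (metis injI reroot_reroot)

lemma sum_prune:
  fixes g :: "nat \<Rightarrow> real"
  assumes "i \<le> z"
  shows "(\<Sum>k<z. g (if k < i then k else Suc k)) = (\<Sum>k\<le>z. g k) - g i"
proof -
  have "(\<Sum>k<z. g (if k < i then k else Suc k)) = (\<Sum>k\<in>{..z} - {i}. g k)"
    using assms
    by (intro sum.reindex_bij_witness[where j = "\<lambda>k. if k < i then k else Suc k"
          and i = "\<lambda>k. if k < i then k else k - 1"]) (auto split: if_splits)
  then show ?thesis using assms by (simp add: sum_diff1)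
qed

lemma branch_prune: "branch (c \<circ> prune i) k = branch c (if k < i then k else Suc k)"
  by (auto simp: branch_def prune_def fun_eq_iff)

lemma branch_swap: "branch (c \<circ> swap i) k = branch c (Transposition.transpose 0 i k)"
  by (auto simp: branch_def swap_def fun_eq_iff)

lemma prune_root: "(c \<circ> prune i) [] = c []" and swap_root: "(c \<circ> swap i) [] = c []"
  by (auto simp: prune_def swap_def)

lemma branch_reroot: "branch (c \<circ> reroot) 0 = c \<circ> prune 0"
  by (auto simp: branch_def reroot_def prune_def fun_eq_iff split: list.splits)

lemma prune_reroot: "(c \<circ> reroot) \<circ> prune 0 = branch c 0"
  by (auto simp: branch_def reroot_def prune_def fun_eq_iff split: list.splits)

context
  fixes l K :: real and f :: "nat \<Rightarrow> real"
  assumes l: "0 \<le> l" "l < 1" and f: "\<And>z. 0 \<le> f z" "\<And>z. f z \<le> K"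
begin

text \<open>With \<open>z = c []\<close> and \<open>H\<close> the sum of \<open>hit\<close> over the \<open>z + 1\<close> branches, the denominators of the pruned trees
  are \<open>1 - l / z * (H - hit i)\<close>, where \<open>hit i\<close> belongs to the branch at \<open>i\<close>. They add up to \<open>z + 1\<close> times the
  denominator \<open>1 - l / (z + 1) * H\<close> of the augmented tree, and the numerators add up in the same way.
  So the augmented value is a convex combination of the pruned ones.\<close>
lemma agw_value_ge_min:
  assumes z: "1 \<le> c []" and m: "\<And>i. i \<le> c [] \<Longrightarrow> m \<le> gw_value l f (c \<circ> prune i)"
  shows "m \<le> agw_value l f c"
proof -
  let ?z = "real (c [])"
  let ?u = "\<lambda>k. occ l f (branch c k)" and ?h = "\<lambda>k. hit l (branch c k)"
  let ?U = "\<Sum>k\<le>c []. ?u k" and ?H = "\<Sum>k\<le>c []. ?h k"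
  have zpos: "0 < ?z" using z by simp
  have "m * (1 - l / ?z * (?H - ?h i)) \<le> f (c []) + l / ?z * (?U - ?u i)" if i: "i \<le> c []" for i
  proof -
    have "gw_value l f (c \<circ> prune i) = (f (c []) + l / ?z * (?U - ?u i)) / (1 - l / ?z * (?H - ?h i))"
      unfolding gw_value_def prune_root branch_prune
      by (subst sum_prune[OF i, of ?u], subst sum_prune[OF i, of ?h]) simp
    moreover have "0 < 1 - l / ?z * (?H - ?h i)"
      using gw_denominator[OF l, of "c \<circ> prune i"] l f z
      unfolding prune_root branch_prune sum_prune[OF i, of ?h] by simp
    ultimately show ?thesis using m[OF i] by (simp only: pos_le_divide_eq)
  qed
  then have "(\<Sum>i\<le>c []. m * (1 - l / ?z * (?H - ?h i))) \<le> (\<Sum>i\<le>c []. f (c []) + l / ?z * (?U - ?u i))"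
    by (intro sum_mono) auto
  moreover have "(\<Sum>i\<le>c []. m * (1 - l / ?z * (H - ?h i))) = m * ((?z + 1) - l / ?z * ((?z + 1) * H - ?H))" for H
    unfolding sum_distrib_left[symmetric] sum_subtractf by (simp add: add.commute)
  moreover have "(\<Sum>i\<le>c []. f (c []) + l / ?z * (U - ?u i)) = (?z + 1) * f (c []) + l / ?z * ((?z + 1) * U - ?U)" for U
    unfolding sum.distrib sum_distrib_left[symmetric] sum_subtractf by (simp add: add.commute)
  moreover have "l / ?z * ((?z + 1) * H - H) = l * H" for H
    using zpos by (simp add: field_simps)
  ultimately have "m * ((?z + 1) - l * ?H) \<le> (?z + 1) * f (c []) + l * ?U" by simp
  then have "m * ((?z + 1) - l * ?H) / (?z + 1) \<le> ((?z + 1) * f (c []) + l * ?U) / (?z + 1)"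
    by (intro divide_right_mono) auto
  moreover have "m * ((?z + 1) - l * H) / (?z + 1) = m * (1 - l / (?z + 1) * H)" for H
    by (simp add: field_simps)
  moreover have "((?z + 1) * f (c []) + l * U) / (?z + 1) = f (c []) + l / (?z + 1) * U" for U
    by (simp add: field_simps)
  ultimately have "m * (1 - l / (?z + 1) * ?H) \<le> f (c []) + l / (?z + 1) * ?U" by simp
  then show ?thesis
    unfolding agw_value_def using agw_denominator[OF l, of c] l f by (simp only: pos_le_divide_eq)
qed

lemma agw_value_bounds: "0 \<le> agw_value l f c" "agw_value l f c \<le> K / (1 - l)"
proof -
  let ?z = "real (c [])" and ?b = "K / (1 - l)"
  let ?H = "\<Sum>k\<le>c []. hit l (branch c k)" and ?U = "\<Sum>k\<le>c []. occ l f (branch c k)"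
  have D: "0 < 1 - l / (?z + 1) * ?H" using agw_denominator[OF l, of c] l f by simp
  show "0 \<le> agw_value l f c"
    unfolding agw_value_def using D f l occ_nonneg[of l f K]
    by (intro divide_nonneg_pos add_nonneg_nonneg mult_nonneg_nonneg sum_nonneg) auto
  have "?U \<le> (\<Sum>k\<le>c []. ?b * (1 - hit l (branch c k)))"
    using occ_bounds(2)[of l f K] l f by (intro sum_mono) auto
  also have "\<dots> = ?b * ((?z + 1) - ?H)"
    unfolding sum_distrib_left[symmetric] sum_subtractf by simp
  finally have "f (c []) + l / (?z + 1) * ?U \<le> K + l / (?z + 1) * (?b * ((?z + 1) - ?H))"
    using f l by (intro add_mono mult_left_mono) auto
  also have "\<dots> = ?b * (1 - l / (?z + 1) * ?H)"
  proof -
    have q: "l / (?z + 1) * (?z + 1) = l" by simp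
    have "?b * (1 - l) = K" using l by simp
    moreover have "K + q * (b * (y - H)) = b * (1 - q * H)" if "b * (1 - l) = K" "q * y = l" for q b y H
      unfolding that[symmetric] by (simp add: algebra_simps)
    ultimately show ?thesis using q by blast
  qed
  finally show "agw_value l f c \<le> K / (1 - l)"
    unfolding agw_value_def using D by (simp only: pos_divide_le_eq)
qed

text \<open>Cutting the edge between the root and its child \<open>0\<close> shows the augmented tree as two trees of the same
  kind joined by an edge, which makes the effect of exchanging the two ends explicit.\<close>
lemma agw_value_two_trees:
  fixes c
  defines "u \<equiv> occ l f (c \<circ> prune 0)" and "h \<equiv> hit l (c \<circ> prune 0)"
    and "u' \<equiv> occ l f (branch c 0)" and "h' \<equiv> hit l (branch c 0)"
  shows "agw_value l f c = (u + h * u') / (1 - h * h')" "h * h' < 1"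
proof -
  let ?q = "l / (real (c []) + 1)"
  let ?U = "\<Sum>k<c []. occ l f (branch c (Suc k))" and ?H = "\<Sum>k<c []. hit l (branch c (Suc k))"
  let ?e = "esc l (c \<circ> prune 0)"
  have b: "branch (c \<circ> prune 0) k = branch c (Suc k)" for k by (simp add: branch_prune)
  have e: "?e = 1 - ?q * ?H" "0 < ?e" using esc_pos[of l "c \<circ> prune 0"] l by (simp_all add: esc_def b)
  have h: "h * ?e = ?q" using hit_rec[of l "c \<circ> prune 0"] l by (simp add: h_def prune_root)
  have u: "u * ?e = f (c []) + ?q * ?U"
    using occ_rec[of l f K "c \<circ> prune 0"] l f by (simp add: u_def prune_root b)
  have "0 \<le> h" "h \<le> l" "0 \<le> h'" "h' \<le> 1"
    using hit_unit[OF l] l f by (auto simp: h_def h'_def)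
  then have "h * h' \<le> l * 1" by (intro mult_mono) auto
  then show less: "h * h' < 1" using l by simp
  have split: "(\<Sum>k\<le>c []. g k) = g 0 + (\<Sum>k<c []. g (Suc k))" for g :: "nat \<Rightarrow> real"
    by (simp add: lessThan_Suc_atMost[symmetric] sum.lessThan_Suc_shift del: sum.lessThan_Suc)
  have "agw_value l f c = (f (c []) + ?q * (u' + ?U)) / (1 - ?q * (h' + ?H))"
    unfolding agw_value_def u'_def h'_def
      split[of "\<lambda>k. occ l f (branch c k)"] split[of "\<lambda>k. hit l (branch c k)"] ..
  also have "\<dots> = (?e * (u + h * u')) / (?e * (1 - h * h'))"
  proof -
    have "f (c []) + ?q * (u' + ?U) = ?e * (u + h * u')" using h u by algebra
    moreover have "1 - ?q * (h' + ?H) = ?e * (1 - h * h')" using h e by algebra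
    ultimately show ?thesis by simp
  qed
  finally show "agw_value l f c = (u + h * u') / (1 - h * h')" using e by simp
qed

lemma agw_value_reroot:
  "agw_value l f (c \<circ> reroot) = occ l f (branch c 0) + hit l (branch c 0) * agw_value l f c"
proof -
  have "(u' + h' * u) / (1 - h' * h) = u' + h' * ((u + h * u') / (1 - h * h'))"
    if "h * h' < 1" for u u' h h' :: real
    using that by (simp add: divide_simps) (simp add: algebra_simps)
  then show ?thesis
    using agw_value_two_trees[of c] agw_value_two_trees(1)[of "c \<circ> reroot"]
    unfolding branch_reroot prune_reroot by simp
qed

lemma agw_value_swap: "i \<le> c [] \<Longrightarrow> agw_value l f (c \<circ> swap i) = agw_value l f c"
proof -
  assume i: "i \<le> c []"
  have "(\<Sum>k\<le>c []. g (Transposition.transpose 0 i k)) = (\<Sum>k\<le>c []. g k)" for g :: "nat \<Rightarrow> real"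
    using i sum.permute[OF permutes_swap_id[of 0 "{..c []}" i], of g] by simp
  from this[of "\<lambda>k. occ l f (branch c k)"] this[of "\<lambda>k. hit l (branch c k)"]
  show ?thesis by (simp add: agw_value_def swap_root branch_swap del: comp_apply)
qed

text \<open>First-step analysis, with each neighbour of the root turned into the root of a reindexed tree.\<close>
lemma agw_value_one_step:
  "agw_value l f c =
     f (c []) + l * ((\<Sum>i\<le>c []. agw_value l f (c \<circ> swap i \<circ> reroot)) / (real (c []) + 1))"
proof -
  let ?q = "l / (real (c []) + 1)" and ?R = "agw_value l f c"
  let ?U = "\<Sum>k\<le>c []. occ l f (branch c k)" and ?H = "\<Sum>k\<le>c []. hit l (branch c k)"
  have "(\<Sum>i\<le>c []. agw_value l f (c \<circ> swap i \<circ> reroot)) = (\<Sum>i\<le>c []. occ l f (branch c i) + hit l (branch c i) * ?R)"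
    by (intro sum.cong refl) (simp add: agw_value_reroot agw_value_swap branch_swap del: comp_apply)
  also have "\<dots> = ?U + ?H * ?R" by (simp add: sum.distrib sum_distrib_right)
  finally have s: "(\<Sum>i\<le>c []. agw_value l f (c \<circ> swap i \<circ> reroot)) = ?U + ?H * ?R" .
  have "?R * (1 - ?q * ?H) = f (c []) + ?q * ?U"
    unfolding agw_value_def using agw_denominator[OF l, of c] l f by simp
  then have "?R = f (c []) + ?q * (?U + ?H * ?R)" by algebra
  then show ?thesis unfolding s by simp
qed

lemma value_mono:
  assumes g: "\<And>z. 0 \<le> g z" "\<And>z. g z \<le> f z"
  shows "agw_value l g c \<le> agw_value l f c"
    and "1 \<le> c [] \<Longrightarrow> gw_value l g c \<le> gw_value l f c"
proof -
  have o: "occ l g c \<le> occ l f c" for c by (rule occ_mono[of l g f K]) (use l f g in auto)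
  show "agw_value l g c \<le> agw_value l f c"
    unfolding agw_value_def using agw_denominator[OF l, of c] l f g o
    by (intro divide_right_mono add_mono mult_left_mono sum_mono) auto
  show "1 \<le> c [] \<Longrightarrow> gw_value l g c \<le> gw_value l f c"
    unfolding gw_value_def using gw_denominator[OF l, of c] l f g o
    by (intro divide_right_mono add_mono mult_left_mono sum_mono) auto
qed

end

section \<open>Comparing the entropy rate with discounted rates\<close>

text \<open>A lower bound for the discounted rates \<open>(1 - l) * gw_value l f c\<close> as \<open>l\<close> tends to one. The functional \<open>occ\<close> is
  controlled for bounded \<open>f\<close> only, hence the truncation, whose level may depend on \<open>l\<close>. With \<open>l\<close>
  restricted to the numbers \<open>n / (n + 1)\<close>, all quantifiers range over countable sets, which keeps the predicate
  measurable.\<close>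
definition discounted_rate_ge :: "real \<Rightarrow> (nat \<Rightarrow> real) \<Rightarrow> (nat list \<Rightarrow> nat) \<Rightarrow> bool" where
  "discounted_rate_ge v f c \<longleftrightarrow> (\<exists>n0. \<forall>n\<ge>n0. \<exists>K::nat.
    v \<le> (1 - real n / (real n + 1)) *
      gw_value (real n / (real n + 1)) (\<lambda>z. min (f z) (real K)) c)"

text \<open>Once \<open>t\<close> is large the sums of \<open>drift\<close> along the walk exceed \<open>(h - e / 2) * t\<close>, and \<open>abel_lower_bound\<close> passes
  this on to the discounted sums, losing another \<open>e / 2\<close> for the finitely many earlier times.\<close>
lemma entropy_rate_le_discounted_rate:
  assumes c: "\<And>u. 1 \<le> c u"
    and lim: "(\<lambda>t. pmf_entropy (srw (tree_nb (tree_of c)) [] t) / real t) \<longlonglongrightarrow> h"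
    and e: "0 < (e::real)"
  shows "discounted_rate_ge (h - e) drift c"
proof -
  let ?p = "srw (tree_nb (tree_of c)) []"
  define a where "a s = measure_pmf.expectation (?p s) (\<lambda>x. drift (c x))" for s
  have a0: "0 \<le> a s" for s
    unfolding a_def by (intro integral_nonneg_AE) (simp add: drift_nonneg)
  have z: "0 < real (c [])" using c[of "[]"] by simp
  have "(\<lambda>t. ln (real (c []) * (real t + 1)) / real t) \<longlonglongrightarrow> 0"
    using z by real_asymp
  then have "(\<lambda>t. pmf_entropy (?p t) / real t - ln (real (c []) * (real t + 1)) / real t) \<longlonglongrightarrow> h - 0"
    using lim by (intro tendsto_diff)
  then have "eventually (\<lambda>t. h - e / 2 < pmf_entropy (?p t) / real t - ln (real (c []) * (real t + 1)) / real t) sequentially"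
    using e by (intro order_tendstoD) auto
  then obtain t0 where t0: "\<And>t. t0 \<le> t \<Longrightarrow>
      h - e / 2 < pmf_entropy (?p t) / real t - ln (real (c []) * (real t + 1)) / real t"
    by (auto simp: eventually_sequentially)
  define C where "C = \<bar>h - e / 2\<bar> * (real t0 + 1)"
  have A: "(h - e / 2) * real t - C \<le> (\<Sum>s<t. a s)" for t
  proof (cases "t0 \<le> t \<and> 0 < t")
    case True
    then have "h - e / 2 < (pmf_entropy (?p t) - ln (real (c []) * (real t + 1))) / real t"
      using t0 by (simp add: diff_divide_distrib)
    then have "(h - e / 2) * real t < pmf_entropy (?p t) - ln (real (c []) * (real t + 1))"
      using True by (simp only: pos_less_divide_eq of_nat_0_less_iff)
    also have "\<dots> \<le> (\<Sum>s<t. a s)"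
      using srw_entropy_le[of c t, OF c] by (simp add: a_def)
    finally have "(h - e / 2) * real t < (\<Sum>s<t. a s)" .
    moreover have "0 \<le> C" by (simp add: C_def)
    ultimately show ?thesis by linarith
  next
    case False
    then have "(h - e / 2) * real t \<le> C"
      unfolding C_def by (intro mult_mono) auto
    moreover have "0 \<le> (\<Sum>s<t. a s)" using a0 by (simp add: sum_nonneg)
    ultimately show ?thesis by linarith
  qed
  \<comment> \<open>From \<open>n0\<close> on, the constant \<open>C\<close> contributes less than \<open>e / 2\<close> after multiplication by \<open>1 - l\<close>.\<close>
  obtain n0 :: nat where n0: "2 * C / e < real n0" using reals_Archimedean2 by blast
  show ?thesis
    unfolding discounted_rate_ge_def
  proof (rule exI[of _ n0], intro allI impI)
    fix n assume n: "n0 \<le> n"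
    define l where "l = real n / (real n + 1)"
    have l: "0 \<le> l" "l < 1" by (auto simp: l_def)
    have l1: "1 - l = 1 / (real n + 1)" by (simp add: l_def field_simps)
    have "2 * C / e < real n + 1" using n0 n by linarith
    then have small: "(1 - l) * C < e / 2" using e unfolding l1 by (simp add: field_simps)
    show "\<exists>K::nat. h - e \<le> (1 - real n / (real n + 1)) *
      gw_value (real n / (real n + 1)) (\<lambda>z. min (drift z) (real K)) c"
    proof (rule ccontr)
      assume "\<not> ?thesis"
      then have less: "(1 - l) * gw_value l (\<lambda>z. min (drift z) (real K)) c < h - e" for K :: nat
        by (auto simp: l_def not_le)
      have "(\<Sum>s<N. l ^ s * a s) \<le> (h - e) / (1 - l)" for N
      proof -
        let ?S = "\<Union>s<N. set_pmf (?p s)"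
        have fin: "finite (set_pmf (?p s))" for s using srw_support[of c, OF c] by auto
        then have "finite ((\<lambda>x. drift (c x)) ` ?S)" by auto
        then have b: "drift (c x) \<le> Max ((\<lambda>x. drift (c x)) ` ?S)" if "x \<in> ?S" for x
          using that by (intro Max_ge) auto
        \<comment> \<open>Up to time \<open>N\<close> the walk sees finitely many vertices, so \<open>drift\<close> may be truncated.\<close>
        obtain K :: nat where K: "Max ((\<lambda>x. drift (c x)) ` ?S) \<le> real K" using real_arch_simple by blast
        have "(\<Sum>s<N. l ^ s * a s) =
          (\<Sum>s<N. l ^ s * measure_pmf.expectation (?p s) (\<lambda>x. min (drift (c x)) (real K)))"
        proof (rule sum.cong[OF refl])
          fix s assume "s \<in> {..<N}"
          then have "min (drift (c x)) (real K) = drift (c x)" if "x \<in> set_pmf (?p s)" for x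
            using order_trans[OF b[of x] K] that by (intro min_absorb1) blast
          then have "a s = measure_pmf.expectation (?p s) (\<lambda>x. min (drift (c x)) (real K))"
            unfolding a_def by (intro integral_cong_AE) (auto simp: AE_measure_pmf_iff)
          then show "l ^ s * a s =
            l ^ s * measure_pmf.expectation (?p s) (\<lambda>x. min (drift (c x)) (real K))" by simp
        qed
        also have "\<dots> \<le> gw_value l (\<lambda>z. min (drift z) (real K)) c"
          by (rule discounted_sum_le_gw_value[of l _ "real K"]) (use l c drift_nonneg in auto)
        also have "\<dots> \<le> (h - e) / (1 - l)"
          using less[of K] l by (simp add: pos_le_divide_eq mult.commute)
        finally show ?thesis .
      qed
      from abel_lower_bound[OF a0 l A this]
      have "h - e / 2 \<le> (1 - l) * ((h - e) / (1 - l) + C)" .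
      also have "\<dots> = h - e + (1 - l) * C" using l by (simp add: distrib_left)
      finally show False using small by linarith
    qed
  qed
qed

section \<open>Independent offspring numbers and invariance under reindexing\<close>

text \<open>Convergence with countable quantifiers only, for the measurability of events of convergence.\<close>
lemma LIMSEQ_iff_inverse_Suc:
  fixes X :: "nat \<Rightarrow> real"
  shows "X \<longlonglongrightarrow> h \<longleftrightarrow> (\<forall>m::nat. \<exists>N. \<forall>n\<ge>N. \<bar>X n - h\<bar> < inverse (real (Suc m)))"
proof
  assume "X \<longlonglongrightarrow> h"
  then have "\<exists>N. \<forall>n\<ge>N. \<bar>X n - h\<bar> < r" if "0 < r" for r
    using that unfolding LIMSEQ_iff real_norm_def by blast
  then show "\<forall>m::nat. \<exists>N. \<forall>n\<ge>N. \<bar>X n - h\<bar> < inverse (real (Suc m))" by simp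
next
  assume *: "\<forall>m::nat. \<exists>N. \<forall>n\<ge>N. \<bar>X n - h\<bar> < inverse (real (Suc m))"
  show "X \<longlonglongrightarrow> h" unfolding LIMSEQ_iff real_norm_def
  proof (intro allI impI)
    fix r :: real assume "0 < r"
    then obtain m where "inverse (real (Suc m)) < r" using reals_Archimedean by blast
    with * show "\<exists>N. \<forall>n\<ge>N. \<bar>X n - h\<bar> < r" by (meson less_trans)
  qed
qed

lemma branch_eq_comp: "branch c k = c \<circ> Cons k"
  by (simp add: branch_def comp_def)

definition gw_law :: "nat measure \<Rightarrow> (nat list \<Rightarrow> nat) measure" where
  "gw_law D = Pi\<^sub>M UNIV (\<lambda>_. D)"

context
  fixes D :: "nat measure"
  assumes D: "prob_space D" and sets_D [measurable_cong]: "sets D = sets (count_space UNIV)"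
begin

lemma prob_space_gw_law: "prob_space (gw_law D)"
  unfolding gw_law_def by (intro prob_space_PiM D)

lemma measurable_label [measurable]: "(\<lambda>c. c u) \<in> gw_law D \<rightarrow>\<^sub>M count_space UNIV"
proof -
  have "(\<lambda>c. c u) \<in> gw_law D \<rightarrow>\<^sub>M D"
    unfolding gw_law_def by (rule measurable_component_singleton) simp
  then show ?thesis using measurable_cong_sets[OF refl sets_D, of "gw_law D"] by simp
qed

lemma distr_label: "distr (gw_law D) D (\<lambda>c. c u) = D"
  unfolding gw_law_def
  by (rule distr_PiM_component) (auto simp: D)

lemma measurable_reindex [measurable]: "(\<lambda>c. c \<circ> \<rho>) \<in> gw_law D \<rightarrow>\<^sub>M gw_law D"
  unfolding gw_law_def comp_def
  by (rule measurable_PiM_single') (auto simp: space_PiM)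

lemma distr_reindex:
  assumes "inj \<rho>"
  shows "distr (gw_law D) (gw_law D) (\<lambda>c. c \<circ> \<rho>) = gw_law D"
  using distr_PiM_reindex[of UNIV "\<lambda>_. D" \<rho> UNIV] D assms
  by (simp add: gw_law_def comp_def restrict_def)

lemma nn_integral_reindex:
  assumes "inj \<rho>" and [measurable]: "F \<in> borel_measurable (gw_law D)"
  shows "(\<integral>\<^sup>+c. F (c \<circ> \<rho>) \<partial>gw_law D) = (\<integral>\<^sup>+c. F c \<partial>gw_law D)"
proof -
  have "(\<integral>\<^sup>+c. F c \<partial>gw_law D) = (\<integral>\<^sup>+c. F c \<partial>distr (gw_law D) (gw_law D) (\<lambda>c. c \<circ> \<rho>))"
    by (simp add: distr_reindex[OF assms(1)])
  also have "\<dots> = (\<integral>\<^sup>+c. F (c \<circ> \<rho>) \<partial>gw_law D)"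
    by (rule nn_integral_distr) measurable
  finally show ?thesis by simp
qed

lemma AE_reindex:
  assumes "inj \<rho>" and "AE c in gw_law D. Q c"
  shows "AE c in gw_law D. Q (c \<circ> \<rho>)"
proof -
  have "AE c in distr (gw_law D) (gw_law D) (\<lambda>c. c \<circ> \<rho>). Q c"
    unfolding distr_reindex[OF assms(1)] by (rule assms(2))
  from AE_distrD[OF measurable_reindex this] show ?thesis .
qed

lemma nn_integral_label:
  "(\<integral>\<^sup>+c. F (c u) \<partial>gw_law D) = (\<integral>\<^sup>+z. F z \<partial>D)"
proof -
  have "(\<integral>\<^sup>+z. F z \<partial>D) = (\<integral>\<^sup>+z. F z \<partial>distr (gw_law D) D (\<lambda>c. c u))"
    by (simp only: distr_label)
  also have "\<dots> = (\<integral>\<^sup>+c. F (c u) \<partial>gw_law D)"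
    by (rule nn_integral_distr) (auto simp: measurable_cong_sets[OF refl sets_D] measurable_cong_sets[OF sets_D refl])
  finally show ?thesis by simp
qed

lemma measurable_branch:
  assumes "F \<in> borel_measurable (gw_law D)"
  shows "(\<lambda>c. F (branch c k)) \<in> borel_measurable (gw_law D)"
  unfolding branch_eq_comp by (rule measurable_compose[OF measurable_reindex assms])

lemma measurable_root_sum:
  fixes F :: "(nat list \<Rightarrow> nat) \<Rightarrow> real"
  assumes F: "F \<in> borel_measurable (gw_law D)"
  shows "(\<lambda>c. \<Sum>k<c []. F (branch c k)) \<in> borel_measurable (gw_law D)"
    and "(\<lambda>c. \<Sum>k\<le>c []. F (branch c k)) \<in> borel_measurable (gw_law D)"
proof -
  have [measurable]: "(\<lambda>c. F (branch c k)) \<in> borel_measurable (gw_law D)" for k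
    by (rule measurable_branch[OF F])
  show "(\<lambda>c. \<Sum>k<c []. F (branch c k)) \<in> borel_measurable (gw_law D)"
    by (rule measurable_compose_countable[where f = "\<lambda>z c. \<Sum>k<z. F (branch c k)"]) measurable
  show "(\<lambda>c. \<Sum>k\<le>c []. F (branch c k)) \<in> borel_measurable (gw_law D)"
    by (rule measurable_compose_countable[where f = "\<lambda>z c. \<Sum>k\<le>z. F (branch c k)"]) measurable
qed

lemma measurable_root_fun [measurable]: "(\<lambda>c. f (c []) :: real) \<in> borel_measurable (gw_law D)"
  by (rule measurable_compose[OF measurable_label]) simp

lemma measurable_hit:
  assumes l: "0 \<le> l" "l < 1"
  shows "hit l \<in> borel_measurable (gw_law D)"
proof (rule borel_measurable_LIMSEQ_real)
  show "(\<lambda>n. hit_n l n c) \<longlonglongrightarrow> hit l c" for c using hit_n_tendsto l by simp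
  show "hit_n l n \<in> borel_measurable (gw_law D)" for n
  proof (induction n)
    case (Suc n)
    note [measurable] = measurable_root_sum[OF Suc]
    show ?case unfolding hit_n.simps by measurable
  qed simp
qed

lemma measurable_vsum: "vsum f n \<in> borel_measurable (gw_law D)"
proof (induction n)
  case (Suc n)
  note [measurable] = measurable_root_sum[OF Suc]
  show ?case unfolding vsum.simps by measurable
qed simp

context
  fixes l K :: real and f :: "nat \<Rightarrow> real"
  assumes l: "0 \<le> l" "l < 1" and f: "\<And>z. 0 \<le> f z" "\<And>z. f z \<le> K"
begin

lemma measurable_occ: "occ l f \<in> borel_measurable (gw_law D)"
proof (rule borel_measurable_LIMSEQ_real)
  show "(\<lambda>n. occ_n l f n c) \<longlonglongrightarrow> occ l f c" for c
    using occ_n_tendsto[of l f K] l f by blast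
  have [measurable]: "esc l \<in> borel_measurable (gw_law D)"
    using measurable_root_sum[OF measurable_hit[OF l]] unfolding esc_def by measurable
  show "occ_n l f n \<in> borel_measurable (gw_law D)" for n
  proof (induction n)
    case (Suc n)
    note [measurable] = measurable_root_sum[OF Suc]
    show ?case unfolding occ_n.simps by measurable
  qed simp
qed

lemma measurable_values:
  "gw_value l f \<in> borel_measurable (gw_law D)" "agw_value l f \<in> borel_measurable (gw_law D)"
proof -
  note [measurable] = measurable_root_sum[OF measurable_hit[OF l]] measurable_root_sum[OF measurable_occ]
  show "gw_value l f \<in> borel_measurable (gw_law D)" "agw_value l f \<in> borel_measurable (gw_law D)"
    unfolding gw_value_def agw_value_def by measurable
qed

end

text \<open>Choosing a uniform branch and moving it to position \<open>0\<close> does not change the mean. Only invariance under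
  each single \<open>swap i\<close> enters: the weight of \<open>i\<close> depends on \<open>c []\<close>, which \<open>swap i\<close> leaves fixed, so the swap
  can be undone term by term.\<close>
lemma nn_integral_swap_average:
  fixes F :: "(nat list \<Rightarrow> nat) \<Rightarrow> ennreal" and m :: "nat \<Rightarrow> nat"
  assumes F [measurable]: "F \<in> borel_measurable (gw_law D)" and m: "AE c in gw_law D. 0 < m (c [])"
  shows "(\<integral>\<^sup>+c. (\<Sum>i<m (c []). F (c \<circ> swap i)) / of_nat (m (c [])) \<partial>gw_law D) = (\<integral>\<^sup>+c. F c \<partial>gw_law D)"
proof -
  define w :: "nat \<Rightarrow> nat \<Rightarrow> ennreal" where "w z i = (if i < m z then 1 / of_nat (m z) else 0)" for z i
  have [measurable]: "(\<lambda>c. w (c []) i) \<in> borel_measurable (gw_law D)" for i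
    by (rule measurable_compose[OF measurable_label]) simp
  have w_sum: "(\<Sum>i. w z i * G i) = (\<Sum>i<m z. G i) / of_nat (m z)" for z and G :: "nat \<Rightarrow> ennreal"
  proof -
    have "(\<Sum>i. w z i * G i) = (\<Sum>i<m z. w z i * G i)"
      by (rule suminf_finite) (auto simp: w_def)
    also have "\<dots> = (\<Sum>i<m z. G i / of_nat (m z))"
      by (intro sum.cong refl) (simp add: w_def ennreal_times_divide mult.commute)
    also have "\<dots> = (\<Sum>i<m z. G i) / of_nat (m z)"
      by (simp add: divide_ennreal_def sum_distrib_right)
    finally show ?thesis .
  qed
  have "(\<integral>\<^sup>+c. (\<Sum>i<m (c []). F (c \<circ> swap i)) / of_nat (m (c [])) \<partial>gw_law D) =
      (\<integral>\<^sup>+c. (\<Sum>i. w (c []) i * F (c \<circ> swap i)) \<partial>gw_law D)"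
    by (simp only: w_sum)
  also have "\<dots> = (\<Sum>i. \<integral>\<^sup>+c. w (c []) i * F (c \<circ> swap i) \<partial>gw_law D)"
    by (rule nn_integral_suminf) measurable
  also have "\<dots> = (\<Sum>i. \<integral>\<^sup>+c. w (c []) i * F c \<partial>gw_law D)"
    using nn_integral_reindex[OF inj_swap, of "\<lambda>c. w (c []) i * F c" i for i]
    by (intro suminf_cong) (simp add: swap_root)
  also have "\<dots> = (\<integral>\<^sup>+c. (\<Sum>i. w (c []) i * F c) \<partial>gw_law D)"
    by (rule nn_integral_suminf[symmetric]) measurable
  also have "\<dots> = (\<integral>\<^sup>+c. F c \<partial>gw_law D)"
  proof (rule nn_integral_cong_AE, use m in eventually_elim)
    case (elim c)
    then show ?case
      unfolding w_sum
      by (simp add: mult.commute[of _ "F c"] ennreal_mult_divide_eq)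
  qed
  finally show ?thesis .
qed

end

section \<open>Mean discounted sums on the augmented tree\<close>

context
  fixes D :: "nat measure"
  assumes D: "prob_space D" and sets_D [measurable_cong]: "sets D = sets (count_space UNIV)"
begin

interpretation gw: prob_space "gw_law D"
  by (rule prob_space_gw_law[OF D sets_D])

lemmas [measurable] = measurable_label[OF D sets_D] measurable_root_fun[OF D sets_D]
  measurable_reindex[OF D sets_D] measurable_vsum[OF D sets_D]

text \<open>Stationarity of the augmented tree. Reindexing invariance turns the mean of the one-step equation into
  \<open>x = E (f Z) + l * x\<close> for the mean value \<open>x\<close>; it determines \<open>x\<close> because \<open>f\<close> is bounded.\<close>
lemma discounted_agw_mean:
  assumes l: "0 \<le> l" "l < 1" and f: "\<And>z. 0 \<le> f z" "\<And>z. f z \<le> K"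
  shows "(\<integral>\<^sup>+c. ennreal ((1 - l) * agw_value l f c) \<partial>gw_law D) = (\<integral>\<^sup>+z. ennreal (f z) \<partial>D)"
proof -
  let ?R = "agw_value l f"
  let ?G = "\<lambda>c. ennreal (?R (c \<circ> reroot))"
  have R [measurable]: "?R \<in> borel_measurable (gw_law D)"
    using measurable_values(2)[OF D sets_D, of l f K] l f by blast
  have [measurable]: "(\<lambda>c. ?R (c \<circ> reroot)) \<in> borel_measurable (gw_law D)"
    by (rule measurable_compose[OF measurable_reindex[OF D sets_D] R])
  have bounds: "0 \<le> ?R c" "?R c \<le> K / (1 - l)" for c
    using agw_value_bounds[of l f K c] l f by auto
  let ?A = "\<lambda>c. (\<Sum>i<Suc (c []). ?G (c \<circ> swap i)) / of_nat (Suc (c []))"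
  have [measurable]: "?A \<in> borel_measurable (gw_law D)"
  proof (rule measurable_compose_countable[where f = "\<lambda>z c. (\<Sum>i<Suc z. ?G (c \<circ> swap i)) / of_nat (Suc z)"])
    have [measurable]: "(\<lambda>c. ?G (c \<circ> swap i)) \<in> borel_measurable (gw_law D)" for i
      by (rule measurable_compose[OF measurable_reindex[OF D sets_D], of ?G]) measurable
    show "(\<lambda>c. (\<Sum>i<Suc z. ?G (c \<circ> swap i)) / of_nat (Suc z)) \<in> borel_measurable (gw_law D)" for z
      by measurable
  qed measurable
  have step: "ennreal (?R c) = ennreal (f (c [])) + ennreal l * ?A c" for c
  proof -
    have S: "0 \<le> (\<Sum>i\<le>c []. ?R (c \<circ> swap i \<circ> reroot))" by (intro sum_nonneg bounds)
    have "ennreal (?R c) = ennreal (f (c []) + l * ((\<Sum>i\<le>c []. ?R (c \<circ> swap i \<circ> reroot)) / (real (c []) + 1)))"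
      by (subst agw_value_one_step[of l f K]) (use l f in auto)
    also have "\<dots> = ennreal (f (c [])) + ennreal l * ennreal ((\<Sum>i\<le>c []. ?R (c \<circ> swap i \<circ> reroot)) / (real (c []) + 1))"
    proof -
      have split: "ennreal (a + l * b) = ennreal a + ennreal l * ennreal b" if "0 \<le> a" "0 \<le> b" for a b
        using that l by (simp add: ennreal_plus ennreal_mult)
      show ?thesis by (rule split) (use f S in auto)
    qed
    also have "ennreal ((\<Sum>i\<le>c []. ?R (c \<circ> swap i \<circ> reroot)) / (real (c []) + 1)) = ?A c"
    proof -
      have den: "(of_nat (Suc (c [])) :: ennreal) = ennreal (real (c []) + 1)"
        unfolding ennreal_of_nat_eq_real_of_nat by (simp add: add.commute)
      have num: "(\<Sum>i<Suc (c []). ?G (c \<circ> swap i)) = ennreal (\<Sum>i\<le>c []. ?R (c \<circ> swap i \<circ> reroot))"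
        unfolding lessThan_Suc_atMost by (rule sum_ennreal) (rule bounds)
      show ?thesis unfolding num den by (rule divide_ennreal[symmetric, OF S]) simp
    qed
    finally show ?thesis .
  qed
  define x where "x = (\<integral>\<^sup>+c. ennreal (?R c) \<partial>gw_law D)"
  define a where "a = (\<integral>\<^sup>+z. ennreal (f z) \<partial>D)"
  have "x = (\<integral>\<^sup>+c. ennreal (f (c [])) + ennreal l * ?A c \<partial>gw_law D)"
    unfolding x_def by (intro nn_integral_cong step)
  also have "\<dots> = (\<integral>\<^sup>+c. ennreal (f (c [])) \<partial>gw_law D) + ennreal l * (\<integral>\<^sup>+c. ?A c \<partial>gw_law D)"
    by (subst nn_integral_add, measurable, subst nn_integral_cmult, measurable)
  also have "(\<integral>\<^sup>+c. ennreal (f (c [])) \<partial>gw_law D) = a"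
    unfolding a_def by (rule nn_integral_label[OF D sets_D, of "\<lambda>z. ennreal (f z)"])
  also have "(\<integral>\<^sup>+c. ?A c \<partial>gw_law D) = (\<integral>\<^sup>+c. ?G c \<partial>gw_law D)"
    by (rule nn_integral_swap_average[OF D sets_D, of ?G Suc]) auto
  also have "\<dots> = x"
    unfolding x_def by (rule nn_integral_reindex[OF D sets_D inj_reroot, of "\<lambda>c. ennreal (?R c)"]) measurable
  finally have x: "x = a + ennreal l * x" .
  \<comment> \<open>The equation determines \<open>x\<close> only once \<open>x\<close> is known to be finite.\<close>
  have "x \<le> (\<integral>\<^sup>+c. ennreal (K / (1 - l)) \<partial>gw_law D)"
    unfolding x_def by (intro nn_integral_mono ennreal_leI bounds)
  then have "x < \<top>" by (simp add: gw.emeasure_space_1 le_less_trans)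
  then obtain r where r: "0 \<le> r" "x = ennreal r" by (cases x) auto
  have "a \<le> x" using x by (metis le_iff_add)
  with \<open>x < \<top>\<close> obtain s where s: "0 \<le> s" "a = ennreal s" by (cases a) (auto simp: top_unique)
  have "ennreal r = ennreal (s + l * r)"
    using x l r s by (simp add: ennreal_mult)
  then have "r = s + l * r" using r s l by (subst (asm) ennreal_inj) auto
  then have "(1 - l) * r = s" by (simp add: algebra_simps)
  moreover have "(\<integral>\<^sup>+c. ennreal ((1 - l) * ?R c) \<partial>gw_law D) = ennreal (1 - l) * x"
    unfolding x_def using l bounds
    by (subst nn_integral_cmult[symmetric]) (auto simp: ennreal_mult)
  ultimately show ?thesis
    using r s l unfolding a_def[symmetric] by (simp flip: ennreal_mult)
qed

lemma measurable_discounted_rate_ge: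
  assumes f: "\<And>z. 0 \<le> f z"
  shows "Measurable.pred (gw_law D) (discounted_rate_ge v f)"
proof -
  have [measurable]: "gw_value (real n / (real n + 1)) (\<lambda>z. min (f z) (real K)) \<in> borel_measurable (gw_law D)"
    for n K :: nat
    by (rule measurable_values(1)[OF D sets_D, of _ _ "real K"]) (use f in auto)
  show ?thesis unfolding discounted_rate_ge_def by measurable
qed

text \<open>A lower bound \<open>v\<close> for the discounted rate that holds for almost every Galton--Watson tree holds for all
  pruned trees of almost every augmented tree, hence for the augmented tree itself, whose mean is known.
  Monotone convergence removes the truncation and Fatou's lemma the discounting.\<close>
lemma discounted_rate_le_mean:
  assumes f: "\<And>z. 0 \<le> f z"
    and pos: "AE c in gw_law D. 1 \<le> c []"
    and rate: "AE c in gw_law D. discounted_rate_ge v f c"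
  shows "ennreal v \<le> (\<integral>\<^sup>+z. ennreal (f z) \<partial>D)"
proof -
  let ?l = "\<lambda>n::nat. real n / (real n + 1)"
  let ?f = "\<lambda>(K::nat) z. min (f z) (real K)"
  let ?a = "\<lambda>n K c. ennreal ((1 - ?l n) * agw_value (?l n) (?f K) c)"
  define B where "B n c = (SUP K. ?a n K c)" for n c
  have l: "0 \<le> ?l n" "?l n < 1" for n by auto
  have fK: "0 \<le> ?f K z" "?f K z \<le> real K" "?f K z \<le> f z" for K z using f by auto
  have [measurable]: "agw_value (?l n) (?f K) \<in> borel_measurable (gw_law D)" for n K
    by (rule measurable_values(2)[OF D sets_D, of _ _ "real K"]) (use l fK in auto)
  have [measurable]: "B n \<in> borel_measurable (gw_law D)" for n
    unfolding B_def by measurable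
  have mono: "?f K z \<le> ?f K' z" if "K \<le> K'" for K K' z using that by auto
  have B: "(\<integral>\<^sup>+c. B n c \<partial>gw_law D) \<le> (\<integral>\<^sup>+z. ennreal (f z) \<partial>D)" for n
  proof -
    have "incseq (?a n)"
      unfolding incseq_def le_fun_def
    proof (intro allI impI ennreal_leI mult_left_mono)
      fix K K' :: nat and c assume "K \<le> K'"
      then show "agw_value (?l n) (?f K) c \<le> agw_value (?l n) (?f K') c"
        by (intro value_mono(1)[of _ "?f K'" "real K'"] l fK mono)
    qed (use l in auto)
    then have "(\<integral>\<^sup>+c. B n c \<partial>gw_law D) = (SUP K. \<integral>\<^sup>+c. ?a n K c \<partial>gw_law D)"
      unfolding B_def by (rule nn_integral_monotone_convergence_SUP) measurable
    also have "\<dots> = (SUP K. \<integral>\<^sup>+z. ennreal (?f K z) \<partial>D)"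
      by (intro SUP_cong refl, rule discounted_agw_mean[where K = "real _"]) (rule l fK)+
    also have "\<dots> \<le> (\<integral>\<^sup>+z. ennreal (f z) \<partial>D)"
      by (intro SUP_least nn_integral_mono ennreal_leI fK)
    finally show ?thesis .
  qed
  have "AE c in gw_law D. discounted_rate_ge v f (c \<circ> prune i)" for i
    by (rule AE_reindex[OF D sets_D inj_prune rate])
  then have "AE c in gw_law D. \<forall>i. discounted_rate_ge v f (c \<circ> prune i)"
    by (simp add: AE_all_countable)
  then have "AE c in gw_law D. ennreal v \<le> liminf (\<lambda>n. B n c)"
    using pos
  proof eventually_elim
    case (elim c)
    from elim(1) obtain n0 where n0: "\<And>i n. n0 i \<le> n \<Longrightarrow> \<exists>K::nat.
        v \<le> (1 - ?l n) * gw_value (?l n) (?f K) (c \<circ> prune i)"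
      unfolding discounted_rate_ge_def by metis
    have "ennreal v \<le> B n c" if n: "Max (n0 ` {..c []}) \<le> n" for n
    proof -
      have "\<exists>K::nat. i \<le> c [] \<longrightarrow> v \<le> (1 - ?l n) * gw_value (?l n) (?f K) (c \<circ> prune i)" for i
        using n0[of i n] n by (cases "i \<le> c []") auto
      then obtain K where K: "\<And>i. i \<le> c [] \<Longrightarrow>
          v \<le> (1 - ?l n) * gw_value (?l n) (?f (K i)) (c \<circ> prune i)"
        by metis
      \<comment> \<open>One truncation level for all the pruned trees, which are finitely many.\<close>
      define M where "M = Max (K ` {..c []})"
      have "v / (1 - ?l n) \<le> agw_value (?l n) (?f M) c"
      proof (rule agw_value_ge_min[of _ _ "real M"])
        fix i assume i: "i \<le> c []"
        then have "K i \<le> M" by (auto simp: M_def)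
        then have "gw_value (?l n) (?f (K i)) (c \<circ> prune i) \<le> gw_value (?l n) (?f M) (c \<circ> prune i)"
          using elim(2) by (intro value_mono(2)[of _ "?f M" "real M"] l fK mono) auto
        then have "(1 - ?l n) * gw_value (?l n) (?f (K i)) (c \<circ> prune i) \<le>
            (1 - ?l n) * gw_value (?l n) (?f M) (c \<circ> prune i)"
          using l[of n] by (intro mult_left_mono) auto
        with K[OF i] have "v \<le> (1 - ?l n) * gw_value (?l n) (?f M) (c \<circ> prune i)" by linarith
        then show "v / (1 - ?l n) \<le> gw_value (?l n) (?f M) (c \<circ> prune i)"
          using l[of n] by (subst pos_divide_le_eq) (auto simp only: mult.commute diff_gt_0_iff_gt)
      qed (use l fK elim(2) in auto)
      then have "v \<le> (1 - ?l n) * agw_value (?l n) (?f M) c"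
        using l[of n] by (subst (asm) pos_divide_le_eq) (auto simp only: mult.commute diff_gt_0_iff_gt)
      then show ?thesis unfolding B_def by (intro SUP_upper2[of M] ennreal_leI) auto
    qed
    then show ?case by (intro Liminf_bounded) (unfold eventually_sequentially, blast)
  qed
  then have "(\<integral>\<^sup>+c. ennreal v \<partial>gw_law D) \<le> (\<integral>\<^sup>+c. liminf (\<lambda>n. B n c) \<partial>gw_law D)"
    by (rule nn_integral_mono_AE)
  also have "\<dots> \<le> liminf (\<lambda>n. \<integral>\<^sup>+c. B n c \<partial>gw_law D)"
    by (rule nn_integral_liminf) measurable
  also have "\<dots> \<le> liminf (\<lambda>n::nat. \<integral>\<^sup>+z. ennreal (f z) \<partial>D)"
    by (rule Liminf_mono) (simp add: B)
  also have "\<dots> = (\<integral>\<^sup>+z. ennreal (f z) \<partial>D)"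
    by (rule Liminf_const) simp
  finally show ?thesis by (simp add: gw.emeasure_space_1)
qed

section \<open>The entropy rate of the nonbacktracking walk\<close>

lemma vsum_mean:
  assumes f: "\<And>z. 0 \<le> f z" and pos: "AE c in gw_law D. 1 \<le> c []"
  shows "(\<integral>\<^sup>+c. ennreal (vsum f n c) \<partial>gw_law D) = of_nat n * (\<integral>\<^sup>+z. ennreal (f z) \<partial>D)"
proof (induction n)
  case (Suc n)
  let ?F = "\<lambda>c. ennreal (vsum f n (branch c 0))"
  let ?A = "\<lambda>c. (\<Sum>i<c []. ?F (c \<circ> swap i)) / of_nat (c [])"
  have [measurable]: "?F \<in> borel_measurable (gw_law D)"
    using measurable_branch[OF D sets_D measurable_vsum[OF D sets_D]] by measurable
  have [measurable]: "?A \<in> borel_measurable (gw_law D)"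
  proof (rule measurable_compose_countable[where f = "\<lambda>z c. (\<Sum>i<z. ?F (c \<circ> swap i)) / of_nat z"])
    have [measurable]: "(\<lambda>c. ?F (c \<circ> swap i)) \<in> borel_measurable (gw_law D)" for i
      by (rule measurable_compose[OF measurable_reindex[OF D sets_D], of ?F]) measurable
    show "(\<lambda>c. (\<Sum>i<z. ?F (c \<circ> swap i)) / of_nat z) \<in> borel_measurable (gw_law D)" for z
      by measurable
  qed measurable
  have "(\<integral>\<^sup>+c. ennreal (vsum f (Suc n) c) \<partial>gw_law D) = (\<integral>\<^sup>+c. ennreal (f (c [])) + ?A c \<partial>gw_law D)"
  proof (rule nn_integral_cong_AE, use pos in eventually_elim)
    case (elim c)
    have S: "0 \<le> (\<Sum>k<c []. vsum f n (branch c k))" by (intro sum_nonneg vsum_nonneg f)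
    have "branch (c \<circ> swap k) 0 = branch c k" for k by (simp add: branch_swap)
    then have num: "(\<Sum>i<c []. ?F (c \<circ> swap i)) = ennreal (\<Sum>k<c []. vsum f n (branch c k))"
      by (simp only:) (rule sum_ennreal, rule vsum_nonneg, rule f)
    have "?A c = ennreal ((\<Sum>k<c []. vsum f n (branch c k)) / real (c []))"
      unfolding num ennreal_of_nat_eq_real_of_nat
      by (rule divide_ennreal[OF S]) (use elim in simp)
    then show ?case
      unfolding vsum.simps using S f by (subst ennreal_plus) auto
  qed
  also have "\<dots> = (\<integral>\<^sup>+c. ennreal (f (c [])) \<partial>gw_law D) + (\<integral>\<^sup>+c. ?A c \<partial>gw_law D)"
    by (rule nn_integral_add) measurable
  also have "(\<integral>\<^sup>+c. ennreal (f (c [])) \<partial>gw_law D) = (\<integral>\<^sup>+z. ennreal (f z) \<partial>D)"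
    by (rule nn_integral_label[OF D sets_D, of "\<lambda>z. ennreal (f z)"])
  also have "(\<integral>\<^sup>+c. ?A c \<partial>gw_law D) = (\<integral>\<^sup>+c. ?F c \<partial>gw_law D)"
    using pos by (intro nn_integral_swap_average[OF D sets_D, of ?F "\<lambda>z. z"]) auto
  also have "\<dots> = (\<integral>\<^sup>+c. ennreal (vsum f n c) \<partial>gw_law D)"
    unfolding branch_eq_comp
    by (rule nn_integral_reindex[OF D sets_D, of "Cons 0" "\<lambda>c. ennreal (vsum f n c)"]) auto
  finally show ?case by (simp add: Suc distrib_right)
qed simp

text \<open>Dominated convergence for \<open>f\<close> truncated at \<open>K\<close>, followed by monotone convergence in \<open>K\<close>.\<close>
lemma mean_le_vsum_rate:
  assumes f: "\<And>z. 0 \<le> f z" and pos: "AE c in gw_law D. 1 \<le> c []"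
    and lim: "AE c in gw_law D. (\<lambda>t. vsum f t c / real t) \<longlonglongrightarrow> h"
  shows "(\<integral>\<^sup>+z. ennreal (f z) \<partial>D) \<le> ennreal h"
proof -
  let ?f = "\<lambda>(K::nat) z. min (f z) (real K)"
  have truncated: "(\<integral>\<^sup>+z. ennreal (?f K z) \<partial>D) \<le> ennreal h" for K
  proof -
    let ?u = "\<lambda>t c. ennreal (min (vsum f t c / real t) (real K))"
    have "(\<lambda>t. \<integral>\<^sup>+c. ?u t c \<partial>gw_law D) \<longlonglongrightarrow> (\<integral>\<^sup>+c. ennreal (min h (real K)) \<partial>gw_law D)"
    proof (rule nn_integral_dominated_convergence[where w = "\<lambda>_. ennreal (real K)"])
      show "AE c in gw_law D. (\<lambda>t. ?u t c) \<longlonglongrightarrow> ennreal (min h (real K))"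
        using lim by eventually_elim (intro tendsto_intros tendsto_ennrealI)
    qed (auto simp: gw.emeasure_space_1 intro!: AE_I2 ennreal_leI)
    moreover have "(\<integral>\<^sup>+z. ennreal (?f K z) \<partial>D) \<le> (\<integral>\<^sup>+c. ?u t c \<partial>gw_law D)" if t: "1 \<le> t" for t
    proof -
      have "of_nat t * (\<integral>\<^sup>+z. ennreal (?f K z) \<partial>D) = (\<integral>\<^sup>+c. ennreal (vsum (?f K) t c) \<partial>gw_law D)"
        by (rule vsum_mean[symmetric]) (use f pos in auto)
      also have "\<dots> \<le> (\<integral>\<^sup>+c. of_nat t * ?u t c \<partial>gw_law D)"
      proof (rule nn_integral_mono)
        fix c
        have "vsum (?f K) t c \<le> vsum f t c" by (rule vsum_mono) simp
        moreover have "vsum (?f K) t c \<le> real t * real K" by (rule vsum_le) auto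
        ultimately have "vsum (?f K) t c \<le> real t * min (vsum f t c / real t) (real K)"
          using t by (simp add: min_def)
        then show "ennreal (vsum (?f K) t c) \<le> of_nat t * ?u t c"
          using vsum_nonneg[of f t c] f
          by (simp add: ennreal_of_nat_eq_real_of_nat ennreal_leI flip: ennreal_mult)
      qed
      also have "\<dots> = of_nat t * (\<integral>\<^sup>+c. ?u t c \<partial>gw_law D)"
        by (rule nn_integral_cmult) measurable
      finally show ?thesis using t
        by (subst (asm) ennreal_mult_le_mult_iff) (auto simp: ennreal_of_nat_eq_real_of_nat)
    qed
    ultimately have "(\<integral>\<^sup>+z. ennreal (?f K z) \<partial>D) \<le> (\<integral>\<^sup>+c. ennreal (min h (real K)) \<partial>gw_law D)"
      by (intro LIMSEQ_le_const) auto
    also have "\<dots> \<le> ennreal h" by (simp add: gw.emeasure_space_1 ennreal_leI)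
    finally show ?thesis .
  qed
  have "(\<integral>\<^sup>+z. ennreal (f z) \<partial>D) = (\<integral>\<^sup>+z. (SUP K. ennreal (?f K z)) \<partial>D)"
  proof (rule nn_integral_cong, rule antisym)
    fix z
    obtain K :: nat where "f z \<le> real K" using real_arch_simple by blast
    then show "ennreal (f z) \<le> (SUP K. ennreal (?f K z))" by (intro SUP_upper2[of K]) auto
  qed (auto intro!: SUP_least ennreal_leI)
  also have "\<dots> = (SUP K. \<integral>\<^sup>+z. ennreal (?f K z) \<partial>D)"
    by (rule nn_integral_monotone_convergence_SUP)
      (auto simp: incseq_def le_fun_def measurable_cong_sets[OF sets_D refl] intro!: ennreal_leI)
  also have "\<dots> \<le> ennreal h" using truncated by (rule SUP_least)
  finally show ?thesis .
qed

end

section \<open>Simple random walk has the smaller entropy\<close>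

theorem proposition1p2:
  fixes M :: "'b measure" and Z :: "'b \<Rightarrow> nat"
    and P :: "'a measure" and N :: "nat list \<Rightarrow> 'a \<Rightarrow> nat"
    and h_X h_Y :: real
  assumes "prob_space M"
    and "Z \<in> measurable M (count_space UNIV)"
    and "integrable M (\<lambda>\<omega>. real (Z \<omega>))"
    and "AE \<omega> in M. Z \<omega> \<ge> 2"
    and "galton_watson P N M Z"
    and "asymptotic_entropy P (\<lambda>\<omega>. srw (tree_nb (tree_of (\<lambda>u. N u \<omega>))) []) h_X"
    and "asymptotic_entropy P (\<lambda>\<omega>. nbrw (tree_nb (tree_of (\<lambda>u. N u \<omega>))) []) h_Y"
  shows "h_X < h_Y"
proof -
  define D where "D = distr M (count_space UNIV) Z"
  have D: "prob_space D"
    unfolding D_def using assms(1,2) by (rule prob_space.prob_space_distr)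
  have sets_D: "sets D = sets (count_space UNIV)" by (simp add: D_def)
  interpret P: prob_space P using assms(5) by (simp add: galton_watson_def)
  interpret D: prob_space D by (rule D)
  have indep: "P.indep_vars (\<lambda>_. count_space UNIV) N UNIV"
    and law: "\<And>u. distr P (count_space UNIV) (N u) = D"
    using assms(5) by (auto simp: galton_watson_def D_def)
  have rv: "N u \<in> P \<rightarrow>\<^sub>M count_space UNIV" for u
    using indep by (auto simp: P.indep_vars_def)
  let ?c = "\<lambda>\<omega> u. N u \<omega>"
  have distr_c: "distr P (gw_law D) ?c = gw_law D"
  proof -
    have "distr P (Pi\<^sub>M UNIV (\<lambda>_. count_space UNIV)) (\<lambda>\<omega>. \<lambda>u\<in>UNIV. N u \<omega>) =
        Pi\<^sub>M UNIV (\<lambda>u. distr P (count_space UNIV) (N u))"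
      using P.indep_vars_iff_distr_eq_PiM'[where I = UNIV and M' = "\<lambda>_. count_space UNIV" and X = N]
        rv indep by simp
    moreover have "sets (gw_law D) = sets (Pi\<^sub>M UNIV (\<lambda>_::nat list. count_space UNIV))"
      unfolding gw_law_def by (intro sets_PiM_cong refl sets_D)
    ultimately show ?thesis by (simp add: law restrict_def gw_law_def cong: distr_cong)
  qed
  have c_meas: "?c \<in> P \<rightarrow>\<^sub>M gw_law D"
    unfolding gw_law_def
    by (rule measurable_PiM_single')
      (use rv measurable_cong_sets[OF refl sets_D, of P] sets_eq_imp_space_eq[OF sets_D] in auto)
  have transfer: "AE c in gw_law D. Q c" if "AE \<omega> in P. Q (?c \<omega>)" "Measurable.pred (gw_law D) Q" for Q
  proof -
    have "AE c in distr P (gw_law D) ?c. Q c"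
      using that AE_distr_iff[OF c_meas, of Q] by (simp add: pred_def)
    then show ?thesis by (simp only: distr_c)
  qed
  have D2: "AE z in D. 2 \<le> z"
    unfolding D_def using assms(2,4) by (subst AE_distr_iff) auto
  have two: "AE \<omega> in P. 2 \<le> N u \<omega>" for u
  proof -
    have "AE z in distr P (count_space UNIV) (N u). 2 \<le> z" unfolding law by (rule D2)
    from AE_distrD[OF rv this] show ?thesis .
  qed
  have "AE \<omega> in P. 1 \<le> N u \<omega>" for u
    using two[of u] by eventually_elim simp
  then have label_pos: "AE \<omega> in P. \<forall>u. 1 \<le> N u \<omega>"
    by (simp only: AE_all_countable simp_thms)
  have root_pos: "AE c in gw_law D. 1 \<le> c []"
  proof (rule transfer)
    show "AE \<omega> in P. 1 \<le> N [] \<omega>" using label_pos by eventually_elim simp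
    have [measurable]: "(\<lambda>c. c []) \<in> gw_law D \<rightarrow>\<^sub>M count_space UNIV" by (rule measurable_label[OF D sets_D])
    show "Measurable.pred (gw_law D) (\<lambda>c. 1 \<le> c [])" by measurable
  qed

  let ?ln = "\<lambda>z::nat. ln (real z)"
  have ln0: "0 \<le> ?ln z" for z by (cases "z = 0") auto
  have "AE \<omega> in P. (\<lambda>t. vsum ?ln t (?c \<omega>) / real t) \<longlonglongrightarrow> h_Y"
    using assms(7) label_pos unfolding asymptotic_entropy_def
  proof eventually_elim
    case (elim \<omega>)
    then show ?case by (simp add: nbrw_eq_vis entropy_vis)
  qed
  then have "AE c in gw_law D. (\<lambda>t. vsum ?ln t c / real t) \<longlonglongrightarrow> h_Y"
  proof (rule transfer)
    note [measurable] = measurable_vsum[OF D sets_D]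
    show "Measurable.pred (gw_law D) (\<lambda>c. (\<lambda>t. vsum ?ln t c / real t) \<longlonglongrightarrow> h_Y)"
      unfolding LIMSEQ_iff_inverse_Suc by measurable
  qed
  then have ln_le: "(\<integral>\<^sup>+z. ennreal (?ln z) \<partial>D) \<le> ennreal h_Y"
    by (rule mean_le_vsum_rate[OF D sets_D ln0 root_pos])
  have meas: "g \<in> borel_measurable D" for g :: "nat \<Rightarrow> real"
    by (simp add: measurable_cong_sets[OF sets_D refl])
  have ln_int: "integrable D ?ln"
    using ln_le ln0 meas by (intro integrableI_nonneg) (auto intro: le_less_trans)
  have drift_le: "drift z \<le> ?ln z" for z
    using ln0[of z] mult_right_mono[of "real z / (real z + 1)" 1 "?ln z"] by (simp add: drift_def)
  have drift_int: "integrable D drift"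
    by (rule Bochner_Integration.integrable_bound[OF ln_int meas]) (use drift_nonneg drift_le ln0 in auto)
  have h_Y: "integral\<^sup>L D ?ln \<le> h_Y"
  proof -
    have "ennreal (integral\<^sup>L D ?ln) \<le> ennreal h_Y"
      using ln_le nn_integral_eq_integral[OF ln_int] ln0 by simp
    moreover have "0 < integral\<^sup>L D ?ln"
    proof -
      have "integral\<^sup>L D (\<lambda>_. 0) < integral\<^sup>L D ?ln"
        using D2 by (intro D.integral_less_AE_space ln_int) (auto simp: D.emeasure_space_1 elim!: eventually_mono)
      then show ?thesis by simp
    qed
    ultimately show ?thesis by (metis ennreal_le_iff2 linorder_not_less)
  qed

  have below: "h_X - e \<le> integral\<^sup>L D drift" if e: "0 < e" for e
  proof -
    have "AE \<omega> in P. discounted_rate_ge (h_X - e) drift (?c \<omega>)"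
      using assms(6) label_pos unfolding asymptotic_entropy_def
    proof eventually_elim
      case (elim \<omega>)
      then show ?case
        by (intro entropy_rate_le_discounted_rate e) auto
    qed
    then have "AE c in gw_law D. discounted_rate_ge (h_X - e) drift c"
      by (rule transfer) (rule measurable_discounted_rate_ge[OF D sets_D drift_nonneg])
    from discounted_rate_le_mean[OF D sets_D drift_nonneg root_pos this]
    have "ennreal (h_X - e) \<le> ennreal (integral\<^sup>L D drift)"
      using nn_integral_eq_integral[OF drift_int] drift_nonneg by simp
    then show ?thesis using integral_nonneg_AE[of drift D] drift_nonneg by (simp add: ennreal_le_iff)
  qed
  have "h_X \<le> integral\<^sup>L D drift"
    by (rule field_le_epsilon) (use below in \<open>simp add: diff_le_eq\<close>)
  also have "\<dots> < integral\<^sup>L D ?ln"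
  proof (rule D.integral_less_AE_space[OF drift_int ln_int])
    show "AE z in D. drift z < ?ln z"
      using D2
    proof eventually_elim
      case (elim z)
      then have "0 < ?ln z" by simp
      then have "real z / (real z + 1) * ?ln z < 1 * ?ln z"
        by (intro mult_strict_right_mono) auto
      then show ?case by (simp add: drift_def)
    qed
  qed (simp add: D.emeasure_space_1)
  also note h_Y
  finally show ?thesis .
qed

end
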